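(* Let $n\ge 2$, let $x_1<x_2<\dots<x_n$ be real numbers and let $y_1,\dots,y_n\in\mathbb{R}$. The optimisation problem $$\inf_{f:\mathbb{R}\to\mathbb{R}} \big\|\sqrt{1+x^2}\,f''\big\|_{\mathrm{TV}}\quad\text{such that } f(x_i)=y_i \text{ for all } i\in\{1,\dots,n\}$$ admits a unique minimiser.
   Context: For a Lipschitz function $f:\mathbb{R}\to\mathbb{R}$, $f''$ is its distributional second derivative. If $f''$ is a signed Radon measure with total variation measure $|f''|$, then $\|\sqrt{1+x^2}f''\|_{\mathrm{TV}}=\int_{\mathbb{R}}\sqrt{1+x^2}\,\mathrm{d}|f''|(x)\in[0,+\infty]$. For every other function $f$ (non-Lipschitz, or $f''$ not a measure) this quantity is set to $+\infty$. *)

theory Defs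
  imports "HOL-Analysis.Analysis"
begin

definition test_function :: "(real \<Rightarrow> real) \<Rightarrow> bool" where
  "test_function \<phi> \<longleftrightarrow>
     (\<forall>k x. (deriv ^^ k) \<phi> differentiable (at x)) \<and> compact (closure {x. \<phi> x \<noteq> 0})"

(* A signed Radon measure on the real line is given by its Jordan decomposition, i.e. its
   positive part P and negative part N: mutually singular positive Radon measures.
   On the real line, local finiteness of a Borel measure already implies regularity.
   Both parts may have infinite total mass. *)
definition signed_radon_measure :: "real measure \<Rightarrow> real measure \<Rightarrow> bool" where
  "signed_radon_measure P N \<longleftrightarrow>
     sets P = sets borel \<and> sets N = sets borel \<and>
     (\<forall>K. compact K \<longrightarrow> emeasure P K < \<infinity> \<and> emeasure N K < \<infinity>) \<and>
     (\<exists>A\<in>sets borel. emeasure P (- A) = 0 \<and> emeasure N A = 0)"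

definition total_variation :: "real measure \<Rightarrow> real measure \<Rightarrow> real measure" where
  "total_variation P N = measure_of UNIV (sets borel) (\<lambda>A. emeasure P A + emeasure N A)"

lemma sets_total_variation: "sets (total_variation P N) = sets borel"
  unfolding total_variation_def using sets.sigma_sets_eq[of "borel :: real measure"] by simp

(* measure_of silently yields the zero measure unless its argument is countably additive. *)
lemma emeasure_total_variation:
  assumes "sets P = sets borel" "sets N = sets borel" "A \<in> sets borel"
  shows "emeasure (total_variation P N) A = emeasure P A + emeasure N A"
proof -
  have "countably_additive (sets borel) (\<lambda>A. emeasure P A + emeasure N A)"
    unfolding countably_additive_def
    by (auto simp: assms(1,2) suminf_emeasure[symmetric] suminf_add[symmetric])
  moreover have "positive (sets borel) (\<lambda>A. emeasure P A + emeasure N A)"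
    by (simp add: positive_def)
  moreover have "sigma_algebra UNIV (sets (borel :: real measure))"
    by (metis sets.sigma_algebra_axioms space_borel)
  ultimately show ?thesis
    unfolding total_variation_def using assms(3) by (intro emeasure_measure_of_sigma)
qed

(* The distributional second derivative of f is the signed Radon measure P - N. *)
definition has_second_deriv_measure ::
    "(real \<Rightarrow> real) \<Rightarrow> real measure \<Rightarrow> real measure \<Rightarrow> bool" where
  "has_second_deriv_measure f P N \<longleftrightarrow>
     signed_radon_measure P N \<and>
     (\<forall>\<phi>. test_function \<phi> \<longrightarrow>
        (LINT x|lborel. f x * deriv (deriv \<phi>) x) = (LINT x|P. \<phi> x) - (LINT x|N. \<phi> x))"

(* The measure selected by THE is well defined: the distributional derivative determines
   the signed measure, which in turn determines its Jordan decomposition. *)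
definition weighted_TV :: "(real \<Rightarrow> real) \<Rightarrow> ennreal" where
  "weighted_TV f =
     (if (\<exists>L. L-lipschitz_on UNIV f) \<and> (\<exists>P N. has_second_deriv_measure f P N)
      then \<integral>\<^sup>+ x. ennreal (sqrt (1 + x\<^sup>2))
             \<partial>(THE M. \<exists>P N. has_second_deriv_measure f P N \<and> M = total_variation P N)
      else \<infinity>)"

end

theory Submission
  imports Defs "HOL-Computational_Algebra.Polynomial"
begin

text \<open>The weight is \<open>sqrt (1 + t\<^sup>2) = |(1, t)|\<close>, so an atom of mass \<open>m\<close> at \<open>t\<close>
  costs the norm of its mass and first moment \<open>m (1, t)\<close>. Restricted to splines with one positive
  and one negative knot per interval \<open>[x\<^sub>i, x\<^sub>i\<^sub>+\<^sub>1]\<close>, the problem is a convex cone program whose value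
  is a sublinear function of the data and is attained by compactness. Hahn--Banach gives a linear
  functional of the data below the value and equal to it at \<open>y\<close>. It vanishes on affine data, hence
  it is \<open>f \<mapsto> \<integral> \<eta> df''\<close> for a compactly supported piecewise linear \<open>\<eta>\<close> with nodes \<open>x\<^sub>i\<close>, and
  testing it on hinge functions gives \<open>|\<eta>| \<le> sqrt (1 + t\<^sup>2)\<close>. So the optimal spline is optimal among
  all functions, and \<open>f''\<close> is carried by the contact set \<open>{|\<eta>| = sqrt (1 + t\<^sup>2)}\<close> for every
  minimiser \<open>f\<close>.

  By strict convexity of the weight, a contact point inside a node interval is the only one in the
  closed interval. If every interval had one, tangency and \<open>\<eta> = 0\<close> at \<open>x\<^sub>1\<close> and \<open>x\<^sub>n\<close>
  would be contradictory, so two minimisers agree on some interval, and this agreement propagates from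
  interval to interval.\<close>

section \<open>Smooth approximation of the hinge function\<close>

text \<open>Merging all atoms of one sign in a node interval into one atom of the same mass and
  first moment keeps the values at all nodes and, by the triangle inequality, does not raise the
  cost; this is why two knots per interval suffice. Mass and moment replace mass and position
  because the constraints become linear in them and the cost a norm. The obstacle is that
  \<open>f''\<close> is given only against smooth test functions, whereas \<eta> is piecewise
  linear. Hence one identity is proved by mollification: the sum of \<open>k j * f (z j)\<close> is
  the integral of \<eta> against \<open>f''\<close> whenever \<open>k\<close> annihilates affine
  functions. It serves three ends: trapezoids show that \<open>f\<close> determines its measure, so
  that \<open>THE\<close> in \<open>weighted_TV\<close> is meaningful; the certificate gives the
  lower bound and its equality case; tents show that \<open>f\<close> is affine wherever
  \<open>f''\<close> has no mass. Uniqueness works because the contact set belongs to the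
  certificate and not to the minimiser: two minimisers differ by a function that vanishes at the
  nodes and is affine between contact points.\<close>

lemma iterated_deriv_differentiable:
  fixes f :: "real \<Rightarrow> real"
  assumes "f \<in> S" "\<And>g. g \<in> S \<Longrightarrow> \<exists>g'\<in>S. \<forall>x. (g has_real_derivative g' x) (at x)"
  shows "(deriv ^^ k) f differentiable (at x)"
proof -
  have "(deriv ^^ k) f \<in> S" for k
  proof (induction k)
    case (Suc k)
    then obtain g' where "g' \<in> S" "\<forall>x. ((deriv ^^ k) f has_real_derivative g' x) (at x)"
      using assms(2) by blast
    then have "deriv ((deriv ^^ k) f) = g'" by (auto intro!: DERIV_imp_deriv)
    then show ?case using \<open>g' \<in> S\<close> by simp
  qed (use assms(1) in simp)
  then show ?thesis using assms(2) real_differentiable_def by blast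
qed

text \<open>The standard bump times the prefactors that its derivatives produce. The family is
  closed under differentiation, which yields smoothness by
  \<open>iterated_deriv_differentiable\<close>.\<close>

definition bump :: "real poly \<Rightarrow> nat \<Rightarrow> real \<Rightarrow> real" where
  "bump p k x = (if \<bar>x\<bar> < 1 then poly p x / (1 - x\<^sup>2) ^ k * exp (- 1 / (1 - x\<^sup>2)) else 0)"

lemma continuous_on_Icc_bounded:
  fixes g :: "real \<Rightarrow> real"
  assumes "continuous_on {a..b} g"
  obtains B where "0 < B" "\<And>y. y \<in> {a..b} \<Longrightarrow> \<bar>g y\<bar> \<le> B"
proof -
  have "bounded (g ` {a..b})"
    using compact_continuous_image[OF assms] compact_imp_bounded by auto
  then show ?thesis using that unfolding bounded_pos by auto
qed

lemma power_exp_bound: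
  fixes u :: real
  assumes "0 < u"
  shows "exp (- 1 / u) / u ^ k \<le> real (k + 2) ^ (k + 2) * u\<^sup>2"
proof -
  \<comment> \<open>Two powers more than the \<open>k\<close> to be cancelled, so that
    \<open>u\<^sup>2\<close> survives. The bound is \<open>1 + z \<le> exp z\<close> at
    \<open>z = 1 / u / m\<close>, raised to the power \<open>m\<close>.\<close>
  define m where "m = k + 2"
  have "(1 / u / m) ^ m \<le> exp (1 / u / m) ^ m"
    using assms exp_ge_add_one_self[of "1 / u / m"] by (intro power_mono) (linarith, simp)
  also have "\<dots> = exp (1 / u)" by (subst exp_of_nat_mult[symmetric]) (simp add: m_def)
  finally have "(1 / (u * m)) ^ m \<le> exp (1 / u)" by simp
  then have "inverse (exp (1 / u)) \<le> inverse ((1 / (u * m)) ^ m)"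
    using assms by (intro le_imp_inverse_le) (auto simp: m_def)
  then have "exp (- 1 / u) \<le> (u * m) ^ m"
    by (simp add: exp_minus power_one_over inverse_eq_divide)
  then have "exp (- 1 / u) / u ^ k \<le> (u * m) ^ m / u ^ k"
    using assms by (intro divide_right_mono) auto
  also have "\<dots> = real m ^ m * u\<^sup>2"
    using assms unfolding power_mult_distrib by (simp add: m_def power_add power2_eq_square)
  finally show ?thesis by (simp add: m_def)
qed

lemma has_derivative_zero_quadratic:
  fixes f :: "real \<Rightarrow> real"
  assumes "\<And>x. \<bar>f x\<bar> \<le> C * (x - c)\<^sup>2"
  shows "(f has_real_derivative 0) (at c)"
proof -
  have "f c = 0" using assms[of c] by simp
  have "((\<lambda>x. f x / (x - c)) \<longlongrightarrow> 0) (at c)"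
  proof (rule Lim_null_comparison)
    show "((\<lambda>x. C * \<bar>x - c\<bar>) \<longlongrightarrow> 0) (at c)" by (rule tendsto_eq_intros refl | simp)+
    show "\<forall>\<^sub>F x in at c. norm (f x / (x - c)) \<le> C * \<bar>x - c\<bar>"
      unfolding eventually_at
    proof (intro exI[of _ 1] conjI ballI impI)
      fix x assume "x \<noteq> c \<and> dist x c < 1"
      then show "norm (f x / (x - c)) \<le> C * \<bar>x - c\<bar>"
        using assms[of x] by (simp add: divide_simps power2_eq_square abs_mult[symmetric] mult.assoc)
    qed simp
  qed
  then show ?thesis by (simp add: has_field_derivative_iff \<open>f c = 0\<close>)
qed

text \<open>Inside the unit interval the polynomial is the numerator of the product rule over the
  common denominator \<open>(1 - x\<^sup>2) ^ (k + 2)\<close>. At the end points the bump is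
  dominated by a multiple of \<open>(y - x)\<^sup>2\<close>, so its derivative vanishes
  there.\<close>

lemma bump_derivative:
  defines "v \<equiv> [:1, 0, -1:] :: real poly"
  shows "(bump p k has_real_derivative
    bump (pderiv p * v\<^sup>2 + [:0, 2 * real k:] * p * v - [:0, 2:] * p) (k + 2) x) (at x)"
proof -
  have v: "poly v x = 1 - x\<^sup>2" for x by (simp add: v_def power2_eq_square)
  consider "\<bar>x\<bar> < 1" | "\<bar>x\<bar> = 1" | "\<bar>x\<bar> > 1" by linarith
  then show ?thesis
  proof cases
    case 1
    then have pos: "0 < 1 - x\<^sup>2" by (simp add: abs_square_less_1)
    define i where "i = inverse (1 - x\<^sup>2)"
    have iu: "i * (1 - x\<^sup>2) = 1" using pos by (simp add: i_def)
    have "((\<lambda>x. inverse (1 - x\<^sup>2)) has_real_derivative 2 * x * i\<^sup>2) (at x)"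
      using pos by (auto intro!: derivative_eq_intros simp: i_def power2_eq_square)
    note inv = this
    have "((\<lambda>x. poly p x * inverse (1 - x\<^sup>2) ^ k * exp (- inverse (1 - x\<^sup>2))) has_real_derivative
       poly (pderiv p) x * i ^ k * exp (- i) + poly p x * (real k * i ^ (k - 1) * (2 * x * i\<^sup>2)) * exp (- i)
        - poly p x * i ^ k * exp (- i) * (2 * x * i\<^sup>2)) (at x)"
      by (rule DERIV_cong, (rule DERIV_mult DERIV_power DERIV_fun_exp DERIV_minus poly_DERIV inv)+)
        (simp add: i_def[symmetric] algebra_simps)
    moreover have "poly (pderiv p) x * i ^ k * exp (- i) + poly p x * (real k * i ^ (k - 1) * (2 * x * i\<^sup>2)) * exp (- i)
        - poly p x * i ^ k * exp (- i) * (2 * x * i\<^sup>2)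
       = (poly (pderiv p) x * (1 - x\<^sup>2)\<^sup>2 + 2 * real k * x * poly p x * (1 - x\<^sup>2) - 2 * x * poly p x)
         * i ^ (k + 2) * exp (- i)" (is "?l = ?r")
    proof -
      \<comment> \<open>At \<open>k = 0\<close> the exponent \<open>k - 1\<close> is truncated, but
        the factor \<open>real k\<close> removes the term.\<close>
      have t1: "real k * i ^ (k - 1) * (2 * x * i\<^sup>2) = 2 * real k * x * ((1 - x\<^sup>2) * i ^ (k + 2))"
      proof (cases k)
        case (Suc l)
        have "(1 - x\<^sup>2) * i ^ (k + 2) = (i * (1 - x\<^sup>2)) * (i ^ l * i\<^sup>2)"
          by (simp add: Suc power2_eq_square)
        then have "(1 - x\<^sup>2) * i ^ (k + 2) = i ^ l * i\<^sup>2" by (simp only: iu mult_1_left)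
        then show ?thesis by (simp only: Suc diff_Suc_1 mult_ac)
      qed simp
      have "(1 - x\<^sup>2)\<^sup>2 * i ^ (k + 2) = (i * (1 - x\<^sup>2))\<^sup>2 * i ^ k"
        unfolding power_mult_distrib power_add by simp
      then have t2: "i ^ k = (1 - x\<^sup>2)\<^sup>2 * i ^ (k + 2)" by (simp add: iu)
      have t3: "poly p x * i ^ k * exp (- i) * (2 * x * i\<^sup>2) = 2 * x * poly p x * i ^ (k + 2) * exp (- i)"
        by (simp only: power_add mult_ac)
      have "?l = poly (pderiv p) x * ((1 - x\<^sup>2)\<^sup>2 * i ^ (k + 2)) * exp (- i)
          + poly p x * (2 * real k * x * ((1 - x\<^sup>2) * i ^ (k + 2))) * exp (- i)
          - 2 * x * poly p x * i ^ (k + 2) * exp (- i)"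
        unfolding t1 t3 t2[symmetric] ..
      then show ?thesis by (simp only: ring_distribs mult_ac)
    qed
    ultimately have "((\<lambda>x. poly p x * inverse (1 - x\<^sup>2) ^ k * exp (- inverse (1 - x\<^sup>2))) has_real_derivative
       (poly (pderiv p) x * (1 - x\<^sup>2)\<^sup>2 + 2 * real k * x * poly p x * (1 - x\<^sup>2) - 2 * x * poly p x)
         * i ^ (k + 2) * exp (- i)) (at x)" by (simp only:)
    then have "((\<lambda>x. poly p x / (1 - x\<^sup>2) ^ k * exp (- 1 / (1 - x\<^sup>2))) has_real_derivative
       ((poly (pderiv p) x * (1 - x\<^sup>2)\<^sup>2 + 2 * real k * x * poly p x * (1 - x\<^sup>2) - 2 * x * poly p x)
         / (1 - x\<^sup>2) ^ (k + 2)) * exp (- 1 / (1 - x\<^sup>2))) (at x)"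
      by (simp only: i_def divide_inverse power_inverse mult_minus_left mult_1_left)
    moreover have "poly (pderiv p * v\<^sup>2 + [:0, 2 * real k:] * p * v - [:0, 2:] * p) x
       = poly (pderiv p) x * (1 - x\<^sup>2)\<^sup>2 + 2 * real k * x * poly p x * (1 - x\<^sup>2) - 2 * x * poly p x"
      unfolding poly_add poly_diff poly_mult poly_power v by simp
    then have "bump (pderiv p * v\<^sup>2 + [:0, 2 * real k:] * p * v - [:0, 2:] * p) (k + 2) x
       = ((poly (pderiv p) x * (1 - x\<^sup>2)\<^sup>2 + 2 * real k * x * poly p x * (1 - x\<^sup>2) - 2 * x * poly p x)
         / (1 - x\<^sup>2) ^ (k + 2)) * exp (- 1 / (1 - x\<^sup>2))"
      using 1 by (simp only: bump_def if_True)
    moreover have "\<forall>\<^sub>F y in nhds x. \<bar>y\<bar> < 1"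
      using 1 by (intro order_tendstoD(2)[of abs "\<bar>x\<bar>"] tendsto_intros filterlim_ident)
    then have "\<forall>\<^sub>F y in nhds x. bump p k y = poly p y / (1 - y\<^sup>2) ^ k * exp (- 1 / (1 - y\<^sup>2))"
      by eventually_elim (simp add: bump_def)
    ultimately show ?thesis
      by (subst DERIV_cong_ev[OF refl _ refl]) simp_all
  next
    case 2
    have "continuous_on {-1..1} (poly p)" by (intro continuous_intros)
    then obtain B where B: "B > 0" "\<And>y. y \<in> {-1..1} \<Longrightarrow> \<bar>poly p y\<bar> \<le> B"
      using continuous_on_Icc_bounded by blast
    \<comment> \<open>The factor 4 comes from \<open>1 - y\<^sup>2 = \<bar>x - y\<bar> * \<bar>x +
      y\<bar> \<le> 2 * \<bar>y - x\<bar>\<close>, squared.\<close>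
    define C where "C = B * (real (k + 2) ^ (k + 2) * 4)"
    have "\<bar>bump p k y\<bar> \<le> C * (y - x)\<^sup>2" for y
    proof (cases "\<bar>y\<bar> < 1")
      case True
      then have pos: "0 < 1 - y\<^sup>2" by (simp add: abs_square_less_1)
      have "1 - y\<^sup>2 \<le> 2 * \<bar>y - x\<bar>"
      proof -
        have "\<bar>x - y\<bar> * \<bar>x + y\<bar> = \<bar>x * x - y * y\<bar>"
          by (simp only: abs_mult[symmetric] square_diff_square_factored mult.commute)
        moreover have "x * x = 1" using 2 by (metis abs_mult_self_eq mult_1)
        ultimately have "1 - y\<^sup>2 = \<bar>x - y\<bar> * \<bar>x + y\<bar>" using pos by (simp add: power2_eq_square)
        also have "\<dots> \<le> \<bar>x - y\<bar> * 2" using True 2 by (intro mult_left_mono) auto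
        finally show ?thesis by (simp add: abs_minus_commute)
      qed
      then have sq: "(1 - y\<^sup>2)\<^sup>2 \<le> 4 * (y - x)\<^sup>2"
        using power_mono[of "1 - y\<^sup>2" "2 * \<bar>y - x\<bar>" 2] pos by (simp add: power_mult_distrib)
      have "\<bar>bump p k y\<bar> = \<bar>poly p y\<bar> * (exp (- 1 / (1 - y\<^sup>2)) / (1 - y\<^sup>2) ^ k)"
        using True pos by (simp add: bump_def abs_mult)
      also have "\<dots> \<le> B * (real (k + 2) ^ (k + 2) * (1 - y\<^sup>2)\<^sup>2)"
        using True pos B by (intro mult_mono power_exp_bound B(2)) auto
      also have "\<dots> \<le> B * (real (k + 2) ^ (k + 2) * (4 * (y - x)\<^sup>2))"
        using sq B by (intro mult_left_mono) auto
      finally show ?thesis by (simp add: C_def mult_ac)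
    qed (use B in \<open>simp add: bump_def C_def\<close>)
    then have "(bump p k has_real_derivative 0) (at x)" by (rule has_derivative_zero_quadratic)
    then show ?thesis using 2 by (simp add: bump_def)
  next
    case 3
    have "\<forall>\<^sub>F y in nhds x. 1 < \<bar>y\<bar>"
      using 3 by (intro order_tendstoD(1)[of abs "\<bar>x\<bar>"] tendsto_intros filterlim_ident)
    then have "\<forall>\<^sub>F y in nhds x. bump p k y = 0"
      by eventually_elim (simp add: bump_def)
    then have "(bump p k has_real_derivative 0) (at x)"
      by (subst DERIV_cong_ev[OF refl _ refl]) auto
    then show ?thesis using 3 by (simp add: bump_def)
  qed
qed

lemma antiderivative_exists:
  fixes f :: "real \<Rightarrow> real"
  assumes "\<And>x. isCont f x"
  obtains F where "\<And>x. (F has_real_derivative f x) (at x)"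
  using einterval_antiderivative[of "-\<infinity>" "\<infinity>" f] assms
  by (auto simp: has_real_derivative_iff_has_vector_derivative)

text \<open>\<open>Q\<close> is a second antiderivative of a normalised bump, a hinge rounded off on
  \<open>{-1..1}\<close>. The intercept \<open>q\<close> is left unevaluated, as it cancels in
  combinations whose coefficients sum to 0. \<open>S\<close> witnesses that \<open>Q\<close> is
  smooth.\<close>

lemma smooth_hinge_exists:
  obtains Q R \<rho> :: "real \<Rightarrow> real" and S and C q where
    "Q \<in> S" "\<And>g. g \<in> S \<Longrightarrow> \<exists>g'\<in>S. \<forall>x. (g has_real_derivative g' x) (at x)"
    "\<And>x. (Q has_real_derivative R x) (at x)" "\<And>x. (R has_real_derivative \<rho> x) (at x)"
    "\<And>x. 0 \<le> \<rho> x" "\<And>x. isCont \<rho> x" "\<And>x. 1 \<le> \<bar>x\<bar> \<Longrightarrow> \<rho> x = 0" "(LINT x|lborel. \<rho> x) = 1"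
    "\<And>x. x \<le> -1 \<Longrightarrow> Q x = 0" "\<And>x. 1 \<le> x \<Longrightarrow> Q x = x + q" "\<And>x. \<bar>Q x - max 0 x\<bar> \<le> C"
proof -
  have cont_bump: "isCont (bump p k) x" for p k x
    using bump_derivative DERIV_isCont by blast
  obtain F where F: "\<And>x. (F has_real_derivative bump 1 0 x) (at x)"
    using antiderivative_exists[of "bump 1 0"] cont_bump by blast
  define c where "c = F 1 - F (- 1)"
  have "F (- 1) < F 1"
  proof (rule DERIV_pos_imp_increasing_open[where f = F])
    show "\<exists>y. DERIV F x :> y \<and> 0 < y" if "-1 < x" "x < 1" for x
      using that F[of x] by (intro exI[of _ "bump 1 0 x"]) (auto simp: bump_def)
    show "continuous_on {-1..1} F"
      using F by (intro continuous_at_imp_continuous_on) (auto intro: DERIV_isCont)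
  qed simp
  then have c: "c > 0" by (simp add: c_def)
  define \<rho> where "\<rho> = bump [:1 / c:] 0"
  have \<rho>: "\<rho> x = bump 1 0 x / c" for x by (simp add: \<rho>_def bump_def)
  define R where "R x = (F x - F (- 1)) / c" for x
  have R: "(R has_real_derivative \<rho> x) (at x)" for x
    unfolding R_def \<rho> using c by (auto intro!: derivative_eq_intros F)
  have \<rho>0: "\<rho> x = 0" if "1 \<le> \<bar>x\<bar>" for x using that by (simp add: \<rho>_def bump_def)
  have Rm: "R (-1) = 0" "R 1 = 1" using c by (auto simp: R_def c_def)
  have Rl: "R x = 0" if "x \<le> -1" for x
  proof (cases "x = -1")
    case False
    with that have "x < -1" by simp
    then obtain z where "z < -1" "R (-1) - R x = (-1 - x) * \<rho> z"
      using MVT2[of x "-1" R \<rho>] R by blast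
    then show ?thesis using \<rho>0[of z] Rm by simp
  qed (use Rm in simp)
  have Rr: "R x = 1" if "1 \<le> x" for x
  proof (cases "x = 1")
    case False
    with that have "1 < x" by simp
    then obtain z where "z > 1" "R x - R 1 = (x - 1) * \<rho> z"
      using MVT2[of 1 x R \<rho>] R by blast
    then show ?thesis using \<rho>0[of z] Rm by simp
  qed (use Rm in simp)
  obtain G where G: "\<And>x. (G has_real_derivative R x) (at x)"
    using antiderivative_exists[of R] R DERIV_isCont by blast
  define Q where "Q x = G x - G (-1)" for x
  have Q: "(Q has_real_derivative R x) (at x)" for x
    unfolding Q_def by (auto intro!: derivative_eq_intros G)
  have Ql: "Q x = 0" if "x \<le> -1" for x
  proof (cases "x = -1")
    case False
    with that have "x < -1" by simp
    then obtain z where "z < -1" "Q (-1) - Q x = (-1 - x) * R z"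
      using MVT2[of x "-1" Q R] Q by blast
    then show ?thesis using Rl[of z] by (simp add: Q_def)
  qed (simp add: Q_def)
  define q where "q = Q 1 - 1"
  have Qr: "Q x = x + q" if "1 \<le> x" for x
  proof (cases "x = 1")
    case False
    with that have "1 < x" by simp
    then obtain z where "z > 1" "Q x - Q 1 = (x - 1) * R z"
      using MVT2[of 1 x Q R] Q by blast
    then show ?thesis using Rr[of z] by (simp add: q_def)
  qed (simp add: q_def)
  have "continuous_on {-1..1} Q"
    using Q by (intro continuous_at_imp_continuous_on) (auto intro: DERIV_isCont)
  then have "continuous_on {-1..1} (\<lambda>x. Q x - max 0 x)" by (intro continuous_intros)
  then obtain B where B: "B > 0" "\<And>y. y \<in> {-1..1} \<Longrightarrow> \<bar>Q y - max 0 y\<bar> \<le> B"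
    using continuous_on_Icc_bounded by blast
  have bound: "\<bar>Q x - max 0 x\<bar> \<le> B + \<bar>q\<bar>" for x
    using B(1) B(2)[of x] Ql[of x] Qr[of x] by (cases "x \<le> -1"; cases "1 \<le> x") auto
  define S where "S = insert Q (insert R (range (\<lambda>(p, k). bump p k)))"
  have S: "\<exists>g'\<in>S. \<forall>x. (g has_real_derivative g' x) (at x)" if "g \<in> S" for g
  proof -
    have b: "bump p k \<in> S" for p k unfolding S_def by (auto intro!: image_eqI[of _ _ "(p, k)"])
    have \<rho>R: "\<rho> \<in> S" "R \<in> S" using b by (auto simp: \<rho>_def S_def)
    consider "g = Q" | "g = R" | p k where "g = bump p k" using \<open>g \<in> S\<close> by (auto simp: S_def)
    then show ?thesis
    proof cases
      case 1 then show ?thesis using Q \<rho>R by blast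
    next
      case 2 then show ?thesis using R \<rho>R by blast
    next
      case (3 p k) then show ?thesis using bump_derivative b by metis
    qed
  qed
  have "(LINT x|lborel. \<rho> x * indicator {-1..1} x) = R 1 - R (-1)"
    by (rule integral_FTC_Icc_real) (use R cont_bump in \<open>auto simp: \<rho>_def\<close>)
  moreover have "\<rho> x * indicator {-1..1} x = \<rho> x" for x
    using \<rho>0[of x] by (cases "x \<in> {-1..1}") auto
  ultimately have int: "(LINT x|lborel. \<rho> x) = 1" using Rm by simp
  show ?thesis
  proof (rule that[of Q S R \<rho> q "B + \<bar>q\<bar>"])
    show "Q \<in> S" by (simp add: S_def)
    show "0 \<le> \<rho> x" for x using c by (simp add: \<rho> bump_def)
    show "isCont \<rho> x" for x by (simp add: \<rho>_def cont_bump)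
  qed (use S Q R \<rho>0 int Ql Qr bound in auto)
qed

section \<open>Pairing the second derivative with piecewise linear functions\<close>

lemma integrable_compact_support:
  fixes g :: "real \<Rightarrow> real"
  assumes M: "sets M = sets borel" "\<And>K. compact K \<Longrightarrow> emeasure M K < \<infinity>"
    and g: "continuous_on UNIV g" "\<And>x. x \<notin> {a..b} \<Longrightarrow> g x = 0"
  shows "integrable M g"
proof -
  obtain B where B: "\<And>y. y \<in> {a..b} \<Longrightarrow> \<bar>g y\<bar> \<le> B"
    using continuous_on_Icc_bounded continuous_on_subset[OF g(1) subset_UNIV] by metis
  have meas: "g \<in> borel_measurable M"
    using borel_measurable_continuous_onI[OF g(1)] measurable_cong_sets[OF M(1) refl] by blast
  have "integrable M (\<lambda>x. B * indicator {a..b} x)"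
    using M(2)[of "{a..b}"] by (simp add: M(1))
  then show ?thesis
    by (rule Bochner_Integration.integrable_bound[OF _ meas])
       (use B g(2) in \<open>fastforce simp: indicator_def\<close>)
qed

text \<open>To the left of all \<open>z j\<close> every hinge is linear and the two moment
  conditions cancel the sum; to the right every hinge vanishes.\<close>

lemma hinge_sum_compact_support:
  fixes z :: "'i \<Rightarrow> real"
  assumes "(\<Sum>j\<in>J. k j) = 0" "(\<Sum>j\<in>J. k j * z j) = 0" "\<And>j. j \<in> J \<Longrightarrow> z j \<in> {a..b}" "t \<notin> {a<..<b}"
  shows "(\<Sum>j\<in>J. k j * max 0 (z j - t)) = 0"
proof (cases "t \<le> a")
  case True
  have "(\<Sum>j\<in>J. k j * max 0 (z j - t)) = (\<Sum>j\<in>J. k j * z j - t * k j)"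
    using assms(3) True by (intro sum.cong) (fastforce simp: algebra_simps)+
  then show ?thesis using assms(1,2) by (simp add: sum_subtractf sum_distrib_left[symmetric])
next
  case False
  then show ?thesis using assms(3,4) by (intro sum.neutral) fastforce
qed

text \<open>Extends the defining identity from test functions to hinge combinations. With each hinge
  rounded off at scale \<open>e m\<close>, the sum becomes a test function \<open>\<phi> m\<close>
  uniformly close to \<eta>, while its second derivative puts an approximate identity of weight
  \<open>k j\<close> at \<open>z j\<close>. Both sides of the defining identity then
  converge.\<close>

lemma second_deriv_pairing:
  fixes z :: "'i \<Rightarrow> real"
  assumes f: "has_second_deriv_measure f P N" "L-lipschitz_on UNIV f"
    and J: "finite J" "(\<Sum>j\<in>J. k j) = 0" "(\<Sum>j\<in>J. k j * z j) = 0"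
  defines "\<eta> \<equiv> \<lambda>t. \<Sum>j\<in>J. k j * max 0 (z j - t)"
  shows "integrable P \<eta>" "integrable N \<eta>"
    and "(LINT t|P. \<eta> t) - (LINT t|N. \<eta> t) = (\<Sum>j\<in>J. k j * f (z j))"
proof -
  have PN: "sets P = sets borel" "sets N = sets borel"
      "\<And>K. compact K \<Longrightarrow> emeasure P K < \<infinity>" "\<And>K. compact K \<Longrightarrow> emeasure N K < \<infinity>"
    using f(1) unfolding has_second_deriv_measure_def signed_radon_measure_def by auto
  obtain a b where ab: "\<And>j. j \<in> J \<Longrightarrow> z j \<in> {a..b}" "a \<le> b"
  proof -
    have "bdd_below (z ` J)" "bdd_above (z ` J)" using J(1) by auto
    then obtain a b where "\<And>j. j \<in> J \<Longrightarrow> a \<le> z j \<and> z j \<le> b" unfolding bdd_below_def bdd_above_def by blast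
    then show ?thesis using that[of a "max a b"] by force
  qed
  have \<eta>0: "\<eta> t = 0" if "t \<notin> {a..b}" for t
    unfolding \<eta>_def using that by (intro hinge_sum_compact_support[OF J(2,3) ab(1)]) auto
  have cont_\<eta>: "continuous_on UNIV \<eta>" unfolding \<eta>_def by (intro continuous_intros)
  show int: "integrable P \<eta>" "integrable N \<eta>"
    by (rule integrable_compact_support[OF PN(1,3) cont_\<eta> \<eta>0];
        simp)+ (rule integrable_compact_support[OF PN(2,4) cont_\<eta> \<eta>0]; simp)
  have cont_f: "continuous_on UNIV f" using f(2) by (rule lipschitz_on_continuous_on)
  obtain Q R \<rho> S C q where Q: "Q \<in> S" "\<And>g. g \<in> S \<Longrightarrow> \<exists>g'\<in>S. \<forall>x. (g has_real_derivative g' x) (at x)"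
    "\<And>x. (Q has_real_derivative R x) (at x)" "\<And>x. (R has_real_derivative \<rho> x) (at x)"
    "\<And>x. 0 \<le> \<rho> x" "\<And>x. isCont \<rho> x" "\<And>x. 1 \<le> \<bar>x\<bar> \<Longrightarrow> \<rho> x = 0" "(LINT x|lborel. \<rho> x) = 1"
    "\<And>x. x \<le> -1 \<Longrightarrow> Q x = 0" "\<And>x. 1 \<le> x \<Longrightarrow> Q x = x + q" "\<And>x. \<bar>Q x - max 0 x\<bar> \<le> C"
    using smooth_hinge_exists by metis
  have cont_\<rho>: "continuous_on UNIV \<rho>" using Q(6) by (intro continuous_at_imp_continuous_on) auto
  have cont_Q: "continuous_on UNIV Q" using Q(3) by (intro continuous_at_imp_continuous_on) (auto intro: DERIV_isCont)
  have C: "C \<ge> 0" using Q(11)[of 0] by linarith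
  \<comment> \<open>\<open>e m \<le> 1\<close> keeps the supports of all \<open>\<phi> m\<close>
    inside \<open>{a-1..b+1}\<close>, as dominated convergence requires.\<close>
  define e where "e m = inverse (real (Suc m))" for m
  have e: "0 < e m" "e m \<le> 1" for m by (auto simp: e_def inverse_le_1_iff)
  have e_lim: "e \<longlonglongrightarrow> 0" unfolding e_def by (rule LIMSEQ_inverse_real_of_nat)
  define \<phi> where "\<phi> m t = (\<Sum>j\<in>J. k j * (e m * Q ((z j - t) / e m)))" for m t
  have \<phi>0: "\<phi> m t = 0" if "t \<notin> {a-1..b+1}" for m t
  proof (cases "t < a - 1")
    case True
    have "k j * (e m * Q ((z j - t) / e m)) = k j * z j + (e m * q - t) * k j" if "j \<in> J" for j
    proof -
      have "1 \<le> (z j - t) / e m" using ab(1)[OF that] True e[of m] by (simp add: field_simps)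
      then show ?thesis using Q(10) e(1)[of m] by (simp add: field_simps)
    qed
    then have "\<phi> m t = (\<Sum>j\<in>J. k j * z j) + (e m * q - t) * (\<Sum>j\<in>J. k j)"
      by (simp add: \<phi>_def sum.distrib sum_distrib_left)
    then show ?thesis using J by simp
  next
    case False
    have "(z j - t) / e m \<le> -1" if "j \<in> J" for j
      using ab(1)[OF that] False e[of m] \<open>t \<notin> _\<close> by (simp add: field_simps)
    then show ?thesis using Q(9) by (simp add: \<phi>_def)
  qed
  have \<phi>2: "deriv (deriv (\<phi> m)) t = (\<Sum>j\<in>J. k j * (\<rho> ((z j - t) / e m) / e m))" for m t
  proof -
    have "deriv (\<phi> m) = (\<lambda>t. \<Sum>j\<in>J. - k j * R ((z j - t) / e m))"
    proof
      fix t
      have "(\<phi> m has_real_derivative (\<Sum>j\<in>J. - k j * R ((z j - t) / e m))) (at t)"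
        unfolding \<phi>_def using e(1)[of m]
        by (auto intro!: derivative_eq_intros DERIV_chain2[OF Q(3)] simp: mult.commute)
      then show "deriv (\<phi> m) t = (\<Sum>j\<in>J. - k j * R ((z j - t) / e m))" by (rule DERIV_imp_deriv)
    qed
    moreover have "((\<lambda>t. \<Sum>j\<in>J. - k j * R ((z j - t) / e m)) has_real_derivative
        (\<Sum>j\<in>J. k j * (\<rho> ((z j - t) / e m) / e m))) (at t)"
      using e(1)[of m] by (auto intro!: derivative_eq_intros DERIV_chain2[OF Q(4)] sum.cong)
    ultimately show ?thesis by (auto intro: DERIV_imp_deriv)
  qed
  have test: "test_function (\<phi> m)" for m
    unfolding test_function_def
  proof (intro conjI allI)
    \<comment> \<open>The scalar \<open>c\<close> absorbs the inner derivative
      \<open>- 1 / e m\<close>, so \<open>T\<close> is closed under differentiation;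
      \<open>\<phi> m\<close> is the member with \<open>c = e m\<close> and
      \<open>g = Q\<close>.\<close>
    define T where "T = {\<lambda>t. \<Sum>j\<in>J. k j * (c * g ((z j - t) / e m)) | c g. g \<in> S}"
    show "(deriv ^^ l) (\<phi> m) differentiable at x" for l x
    proof (rule iterated_deriv_differentiable[where S = T])
      show "\<phi> m \<in> T" unfolding T_def \<phi>_def using Q(1) by blast
      fix h assume "h \<in> T"
      then obtain c g where g: "g \<in> S" "h = (\<lambda>t. \<Sum>j\<in>J. k j * (c * g ((z j - t) / e m)))"
        unfolding T_def by blast
      obtain g' where g': "g' \<in> S" "\<And>x. (g has_real_derivative g' x) (at x)" using Q(2) g(1) by blast
      have "(h has_real_derivative (\<Sum>j\<in>J. k j * ((- c / e m) * g' ((z j - t) / e m)))) (at t)" for t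
        unfolding g(2) using e(1)[of m]
        by (auto intro!: derivative_eq_intros DERIV_chain2[OF g'(2)] sum.cong)
      moreover have "(\<lambda>t. \<Sum>j\<in>J. k j * ((- c / e m) * g' ((z j - t) / e m))) \<in> T"
        unfolding T_def using g'(1) by blast
      ultimately show "\<exists>h'\<in>T. \<forall>x. (h has_real_derivative h' x) (at x)" by (intro bexI allI)
    qed
    have "{x. \<phi> m x \<noteq> 0} \<subseteq> {a-1..b+1}" using \<phi>0 by blast
    then have "bounded {x. \<phi> m x \<noteq> 0}" using bounded_closed_interval bounded_subset by blast
    then show "compact (closure {x. \<phi> m x \<noteq> 0})" by simp
  qed
  have weak: "(LINT t|lborel. f t * deriv (deriv (\<phi> m)) t) = (LINT t|P. \<phi> m t) - (LINT t|N. \<phi> m t)" for m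
    using f(1) test unfolding has_second_deriv_measure_def by blast
  have close: "\<bar>\<phi> m t - \<eta> t\<bar> \<le> e m * (C * (\<Sum>j\<in>J. \<bar>k j\<bar>))" for m t
  proof -
    have "\<bar>k j * (e m * Q ((z j - t) / e m)) - k j * max 0 (z j - t)\<bar> \<le> \<bar>k j\<bar> * (e m * C)" for j
    proof -
      have "max 0 (z j - t) = e m * max 0 ((z j - t) / e m)"
        using e(1)[of m] by (auto simp: max_def field_simps)
      then have "k j * (e m * Q ((z j - t) / e m)) - k j * max 0 (z j - t)
          = k j * (e m * (Q ((z j - t) / e m) - max 0 ((z j - t) / e m)))"
        by (simp add: algebra_simps)
      then show ?thesis using e(1)[of m] Q(11)[of "(z j - t) / e m"]
        by (simp add: abs_mult mult_left_mono)
    qed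
    then have "\<bar>\<phi> m t - \<eta> t\<bar> \<le> (\<Sum>j\<in>J. \<bar>k j\<bar> * (e m * C))"
      unfolding \<phi>_def \<eta>_def sum_subtractf[symmetric] by (intro order_trans[OF sum_abs] sum_mono)
    then show ?thesis by (simp add: sum_distrib_left mult_ac)
  qed
  have lim_M: "(\<lambda>m. LINT t|M. \<phi> m t) \<longlonglongrightarrow> (LINT t|M. \<eta> t)"
    if M: "sets M = sets borel" "\<And>K. compact K \<Longrightarrow> emeasure M K < \<infinity>" for M
  proof -
    obtain B where B: "B > 0" "\<And>t. t \<in> {a-1..b+1} \<Longrightarrow> \<bar>\<eta> t\<bar> \<le> B"
      using continuous_on_Icc_bounded continuous_on_subset[OF cont_\<eta> subset_UNIV] by metis
    define D where "D = B + C * (\<Sum>j\<in>J. \<bar>k j\<bar>)"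
    have meas: "g \<in> borel_measurable M" if "continuous_on UNIV g" for g :: "real \<Rightarrow> real"
      using borel_measurable_continuous_onI[OF that] measurable_cong_sets[OF M(1) refl] by blast
    show ?thesis
    proof (rule integral_dominated_convergence[where w = "\<lambda>t. D * indicator {a-1..b+1} t"])
      show "\<eta> \<in> borel_measurable M" by (rule meas[OF cont_\<eta>])
      show "\<phi> m \<in> borel_measurable M" for m
        unfolding \<phi>_def using e(1)[of m]
        by (intro meas continuous_intros continuous_on_compose2[OF cont_Q]) auto
      show "integrable M (\<lambda>t. D * indicator {a-1..b+1} t)"
        using M(2)[of "{a-1..b+1}"] by (simp add: M(1))
      show "AE t in M. (\<lambda>m. \<phi> m t) \<longlonglongrightarrow> \<eta> t"
      proof (rule AE_I2)
        fix t
        have "(\<lambda>m. \<phi> m t - \<eta> t) \<longlonglongrightarrow> 0"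
        proof (rule Lim_null_comparison)
          show "\<forall>\<^sub>F m in sequentially. norm (\<phi> m t - \<eta> t) \<le> e m * (C * (\<Sum>j\<in>J. \<bar>k j\<bar>))"
            using close by simp
          show "(\<lambda>m. e m * (C * (\<Sum>j\<in>J. \<bar>k j\<bar>))) \<longlonglongrightarrow> 0"
            using tendsto_mult_left_zero[OF e_lim] by simp
        qed
        then show "(\<lambda>m. \<phi> m t) \<longlonglongrightarrow> \<eta> t" by (simp add: LIM_zero_iff)
      qed
      show "AE t in M. norm (\<phi> m t) \<le> D * indicator {a-1..b+1} t" for m
      proof (rule AE_I2)
        fix t
        have "e m * (C * (\<Sum>j\<in>J. \<bar>k j\<bar>)) \<le> 1 * (C * (\<Sum>j\<in>J. \<bar>k j\<bar>))"
          using C e(2)[of m] by (intro mult_right_mono mult_nonneg_nonneg sum_nonneg) auto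
        then show "norm (\<phi> m t) \<le> D * indicator {a-1..b+1} t"
          using B(2)[of t] close[of m t] \<phi>0[of t m] by (cases "t \<in> {a-1..b+1}") (auto simp: D_def)
      qed
    qed
  qed
  \<comment> \<open>The substitution \<open>t = s - e m * u\<close> turns the moving kernel into the
    fixed one \<open>\<rho> u\<close>. On its support \<open>e m * \<bar>u\<bar> \<le> 1\<close>, so
    the Lipschitz bound supplies the dominating function.\<close>
  have term_lim: "(\<lambda>m. LINT t|lborel. f t * (\<rho> ((s - t) / e m) / e m)) \<longlonglongrightarrow> f s" for s
  proof -
    have "(LINT t|lborel. f t * (\<rho> ((s - t) / e m) / e m)) = (LINT u|lborel. f (s - e m * u) * \<rho> u)" for m
      using e(1)[of m]
      by (subst lborel_integral_real_affine[of "- e m" _ s]) (auto simp: mult.commute)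
    moreover have "(\<lambda>m. LINT u|lborel. f (s - e m * u) * \<rho> u) \<longlonglongrightarrow> (LINT u|lborel. f s * \<rho> u)"
    proof (rule integral_dominated_convergence[where w = "\<lambda>u. (\<bar>f s\<bar> + L) * \<rho> u"])
      have \<rho>int: "integrable lborel \<rho>"
        by (rule integrable_compact_support[OF _ _ cont_\<rho>, of _ "-1" 1])
           (use Q(7) emeasure_bounded_finite compact_imp_bounded in auto)
      then show "integrable lborel (\<lambda>u. (\<bar>f s\<bar> + L) * \<rho> u)" by simp
      show "(\<lambda>u. f s * \<rho> u) \<in> borel_measurable lborel" using \<rho>int by simp
      show "(\<lambda>u. f (s - e m * u) * \<rho> u) \<in> borel_measurable lborel" for m
        by (simp, intro borel_measurable_continuous_onI continuous_intros
            continuous_on_compose2[OF cont_f] cont_\<rho>) auto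
      show "AE u in lborel. (\<lambda>m. f (s - e m * u) * \<rho> u) \<longlonglongrightarrow> f s * \<rho> u"
      proof (rule AE_I2)
        fix u
        have "(\<lambda>m. s - e m * u) \<longlonglongrightarrow> s - 0 * u" by (intro tendsto_intros e_lim)
        then have "(\<lambda>m. f (s - e m * u)) \<longlonglongrightarrow> f s"
          using continuous_on_tendsto_compose[OF cont_f, of _ s] by simp
        then show "(\<lambda>m. f (s - e m * u) * \<rho> u) \<longlonglongrightarrow> f s * \<rho> u" by (intro tendsto_intros)
      qed
      show "AE u in lborel. norm (f (s - e m * u) * \<rho> u) \<le> (\<bar>f s\<bar> + L) * \<rho> u" for m
      proof (rule AE_I2)
        fix u
        show "norm (f (s - e m * u) * \<rho> u) \<le> (\<bar>f s\<bar> + L) * \<rho> u"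
        proof (cases "\<bar>u\<bar> < 1")
          case True
          have "\<bar>f (s - e m * u) - f s\<bar> \<le> L * (e m * \<bar>u\<bar>)"
            using lipschitz_onD[OF f(2), of "s - e m * u" s] e(1)[of m] by (simp add: dist_real_def abs_mult)
          also have "\<dots> \<le> L * 1"
            using True e[of m] lipschitz_on_nonneg[OF f(2)] mult_le_one[of "e m" "\<bar>u\<bar>"]
            by (intro mult_left_mono) auto
          finally show ?thesis using Q(5)[of u]
            by (simp add: abs_mult) (intro mult_right_mono, auto)
        qed (use Q(7) in simp)
      qed
    qed
    ultimately show ?thesis using Q(8) by simp
  qed
  have "(LINT t|lborel. f t * deriv (deriv (\<phi> m)) t)
      = (\<Sum>j\<in>J. k j * (LINT t|lborel. f t * (\<rho> ((z j - t) / e m) / e m)))" for m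
  proof -
    have int: "integrable lborel (\<lambda>t. f t * (\<rho> ((s - t) / e m) / e m))" for s
    proof (rule integrable_compact_support[where a = "s - 1" and b = "s + 1"])
      show "continuous_on UNIV (\<lambda>t. f t * (\<rho> ((s - t) / e m) / e m))"
        using e(1)[of m] by (intro continuous_intros cont_f continuous_on_compose2[OF cont_\<rho>]) auto
      fix t assume "t \<notin> {s - 1..s + 1}"
      then have "e m \<le> \<bar>s - t\<bar>" using e(2)[of m] by auto
      then have "1 \<le> \<bar>(s - t) / e m\<bar>" using e(1)[of m] by simp
      then show "f t * (\<rho> ((s - t) / e m) / e m) = 0" using Q(7) by simp
    qed (use emeasure_bounded_finite compact_imp_bounded in auto)
    have "(LINT t|lborel. f t * deriv (deriv (\<phi> m)) t)
        = (LINT t|lborel. (\<Sum>j\<in>J. k j * (f t * (\<rho> ((z j - t) / e m) / e m))))"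
      by (simp add: \<phi>2 sum_distrib_left mult_ac)
    also have "\<dots> = (\<Sum>j\<in>J. LINT t|lborel. k j * (f t * (\<rho> ((z j - t) / e m) / e m)))"
      by (intro Bochner_Integration.integral_sum integrable_mult_right int)
    finally show ?thesis by simp
  qed
  moreover have "(\<lambda>m. \<Sum>j\<in>J. k j * (LINT t|lborel. f t * (\<rho> ((z j - t) / e m) / e m)))
      \<longlonglongrightarrow> (\<Sum>j\<in>J. k j * f (z j))"
    by (intro tendsto_sum tendsto_mult tendsto_const term_lim)
  ultimately have "(\<lambda>m. LINT t|lborel. f t * deriv (deriv (\<phi> m)) t) \<longlonglongrightarrow> (\<Sum>j\<in>J. k j * f (z j))"
    by (simp only:)
  moreover have "(\<lambda>m. LINT t|lborel. f t * deriv (deriv (\<phi> m)) t) \<longlonglongrightarrow> (LINT t|P. \<eta> t) - (LINT t|N. \<eta> t)"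
    unfolding weak by (intro tendsto_diff lim_M PN)
  ultimately show "(LINT t|P. \<eta> t) - (LINT t|N. \<eta> t) = (\<Sum>j\<in>J. k j * f (z j))"
    using LIMSEQ_unique by blast
qed

section \<open>Uniqueness of the second derivative measure\<close>

text \<open>Moving the negative parts across avoids subtraction in \<open>ennreal\<close> and leaves
  two positive measures, \<open>P\<close> plus \<open>N'\<close> and \<open>P'\<close> plus
  \<open>N\<close>, which are determined by their values on intervals.\<close>

lemma second_deriv_interval:
  assumes L: "L-lipschitz_on UNIV f"
    and f: "has_second_deriv_measure f P N" "has_second_deriv_measure f P' N'"
    and ab: "a < b"
  shows "emeasure P {a<..<b} + emeasure N' {a<..<b} = emeasure P' {a<..<b} + emeasure N {a<..<b}"
proof -
  \<comment> \<open>trapezoids of height 1 increasing to the indicator of the interval as \<open>d\<close> tends to 0\<close>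
  define T where "T d t = (max 0 (a - t) - max 0 (a + d - t) - max 0 (b - d - t) + max 0 (b - t)) / d" for d t
  define F where "F d = (f a - f (a + d) - f (b - d) + f b) / d" for d
  have pair: "(LINT t|P. T d t) - (LINT t|N. T d t) = F d"
    if "has_second_deriv_measure f P N" for P N d
  proof -
    define J where "J = {..<4::nat}"
    define z k where "z = (\<lambda>j. [a, a + d, b - d, b] ! j)" and "k = (\<lambda>j. [1, -1, -1, 1] ! j / d)"
    have s: "sum g J = g 0 + g 1 + g 2 + g 3" for g :: "nat \<Rightarrow> real"
      by (simp add: J_def eval_nat_numeral)
    have "(LINT t|P. (\<Sum>j\<in>J. k j * max 0 (z j - t))) - (LINT t|N. (\<Sum>j\<in>J. k j * max 0 (z j - t)))
        = (\<Sum>j\<in>J. k j * f (z j))"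
      by (rule second_deriv_pairing(3)[OF that L]) (simp_all add: J_def[symmetric] s, simp_all add: J_def z_def k_def diff_divide_distrib add_divide_distrib)
    then show ?thesis unfolding s by (simp add: z_def k_def T_def F_def diff_divide_distrib add_divide_distrib)
  qed
  \<comment> \<open>The factor \<open>(b - a) / 2\<close> gives
    \<open>a + d m \<le> b - d m\<close>, so the four nodes stay in the order of a
    trapezoid.\<close>
  define d where "d m = (b - a) / 2 * inverse (real (Suc m))" for m
  have d: "0 < d m" "2 * d m \<le> b - a" for m
    using ab mult_right_mono[of "inverse (real (Suc m))" 1 "b - a"]
    by (simp_all add: d_def inverse_le_1_iff mult.commute)
  have d_lim: "d \<longlonglongrightarrow> 0"
    unfolding d_def using tendsto_mult[OF tendsto_const LIMSEQ_inverse_real_of_nat] by simp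
  have T0: "T (d m) t = 0" if "t \<notin> {a<..<b}" for m t
    using that d[of m] by (auto simp: T_def max_def)
  have T1: "\<bar>T (d m) t\<bar> \<le> 1" for m t
  proof -
    have "\<bar>max 0 (a - t) - max 0 (a + d m - t) - max 0 (b - d m - t) + max 0 (b - t)\<bar> \<le> d m"
      using d[of m] by (auto simp: max_def)
    then show ?thesis using d(1)[of m] by (simp add: T_def)
  qed
  have T_lim: "(\<lambda>m. T (d m) t) \<longlonglongrightarrow> indicator {a<..<b} t" for t
  proof (cases "t \<in> {a<..<b}")
    case True
    then have "\<forall>\<^sub>F m in sequentially. d m < min (t - a) (b - t)"
      by (intro order_tendstoD(2)[OF d_lim]) auto
    then have "\<forall>\<^sub>F m in sequentially. T (d m) t = 1"
    proof eventually_elim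
      case (elim m)
      then show ?case using True d[of m] by (auto simp: T_def max_def)
    qed
    then show ?thesis using True by (simp add: tendsto_eventually)
  qed (use T0 in simp)
  have lim: "(\<lambda>m. LINT t|M. T (d m) t) \<longlonglongrightarrow> measure M {a<..<b}" "emeasure M {a<..<b} = ennreal (measure M {a<..<b})"
    if M: "sets M = sets borel" "\<And>K. compact K \<Longrightarrow> emeasure M K < \<infinity>" for M
  proof -
    have meas: "g \<in> borel_measurable M" if "g \<in> borel_measurable borel" for g :: "real \<Rightarrow> real"
      using that measurable_cong_sets[OF M(1) refl] by blast
    have fin: "emeasure M {a<..<b} < \<infinity>"
      using le_less_trans[OF emeasure_mono[of "{a<..<b}" "{a..b}" M] M(2)[of "{a..b}"]]
      by (simp add: M(1) greaterThanLessThan_subseteq_atLeastAtMost_iff)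
    then show "emeasure M {a<..<b} = ennreal (measure M {a<..<b})"
      by (intro emeasure_eq_ennreal_measure) auto
    have "(\<lambda>m. LINT t|M. T (d m) t) \<longlonglongrightarrow> (LINT t|M. indicator {a<..<b} t)"
    proof (rule integral_dominated_convergence[where w = "\<lambda>t. indicator {a<..<b} t"])
      show "integrable M (\<lambda>t. indicator {a<..<b} t :: real)" using fin by (simp add: M(1))
      show "AE t in M. norm (T (d m) t) \<le> indicator {a<..<b} t" for m
        using T0[of _ m] T1[of m] by (intro AE_I2) (auto simp: indicator_def)
    qed (use T_lim in \<open>auto intro!: meas simp: T_def\<close>)
    then show "(\<lambda>m. LINT t|M. T (d m) t) \<longlonglongrightarrow> measure M {a<..<b}"
      by (simp add: M(1) sets_eq_imp_space_eq[OF M(1)])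
  qed
  have F_lim: "(\<lambda>m. F (d m)) \<longlonglongrightarrow> measure P {a<..<b} - measure N {a<..<b}"
    if h: "has_second_deriv_measure f P N" for P N
    unfolding pair[OF h, symmetric]
    using h unfolding has_second_deriv_measure_def signed_radon_measure_def
    by (intro tendsto_diff lim(1)) auto
  have "measure P {a<..<b} - measure N {a<..<b} = measure P' {a<..<b} - measure N' {a<..<b}"
    by (rule LIMSEQ_unique[OF F_lim[OF f(1)] F_lim[OF f(2)]])
  then have "measure P {a<..<b} + measure N' {a<..<b} = measure P' {a<..<b} + measure N {a<..<b}"
    by linarith
  then have "ennreal (measure P {a<..<b} + measure N' {a<..<b}) = ennreal (measure P' {a<..<b} + measure N {a<..<b})"
    by (simp only:)
  moreover have "emeasure M {a<..<b} = ennreal (measure M {a<..<b})" if "M \<in> {P, N, P', N'}" for M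
    using that f unfolding has_second_deriv_measure_def signed_radon_measure_def
    by (intro lim(2)) auto
  ultimately show ?thesis by simp
qed

text \<open>On the Hahn set \<open>A\<close> the measure \<open>N\<close> vanishes, so there
  \<open>P\<close> is at most \<open>P\<close> plus \<open>N'\<close>, which equals
  \<open>P'\<close>; off \<open>A\<close> the measure \<open>P\<close> vanishes. Used in both
  directions, and with complements for the negative parts, this gives uniqueness of the Jordan
  decomposition.\<close>

lemma Jordan_parts_le:
  assumes "sets P = sets borel" "A \<in> sets borel" "emeasure P (- A) = 0" "emeasure N A = 0" "sets N = sets borel"
    and "sets P' = sets borel"
    and eq: "\<And>E. E \<in> sets borel \<Longrightarrow> emeasure P E + emeasure N' E = emeasure P' E + emeasure N E"
    and E: "E \<in> sets borel"
  shows "emeasure P E \<le> emeasure P' E"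
proof -
  have E': "E \<inter> A \<in> sets borel" "E \<inter> - A \<in> sets borel" using assms by auto
  have "emeasure P (E \<inter> - A) = 0" "emeasure N (E \<inter> A) = 0"
    using assms emeasure_mono[of "E \<inter> - A" "- A" P] emeasure_mono[of "E \<inter> A" A N] by auto
  moreover have "E = (E \<inter> A) \<union> (E \<inter> - A)" by blast
  then have "emeasure P E = emeasure P (E \<inter> A) + emeasure P (E \<inter> - A)"
    using plus_emeasure[of "E \<inter> A" P "E \<inter> - A"] E' assms(1) by force
  ultimately have "emeasure P E \<le> emeasure P' (E \<inter> A)"
    using eq[OF E'(1)] by (metis add.right_neutral add_increasing2 order_refl zero_le)
  also have "\<dots> \<le> emeasure P' E" using E assms(6) by (intro emeasure_mono) auto
  finally show ?thesis .
qed

lemma Jordan_parts_unique: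
  assumes "signed_radon_measure P N" "signed_radon_measure P' N'"
    and eq: "\<And>E. E \<in> sets borel \<Longrightarrow> emeasure P E + emeasure N' E = emeasure P' E + emeasure N E"
  shows "P = P'" "N = N'"
proof -
  obtain A where A: "A \<in> sets borel" "emeasure P (- A) = 0" "emeasure N A = 0"
    using assms(1) unfolding signed_radon_measure_def by blast
  obtain A' where A': "A' \<in> sets borel" "emeasure P' (- A') = 0" "emeasure N' A' = 0"
    using assms(2) unfolding signed_radon_measure_def by blast
  have s: "sets P = sets borel" "sets N = sets borel" "sets P' = sets borel" "sets N' = sets borel"
    using assms unfolding signed_radon_measure_def by auto
  show "P = P'"
  proof (rule measure_eqI)
    fix E assume "E \<in> sets P"
    then have E: "E \<in> sets borel" using s by simp
    show "emeasure P E = emeasure P' E"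
      by (intro antisym Jordan_parts_le[of P A N P' N' E] Jordan_parts_le[of P' A' N' P N E])
         (use A A' s E eq in \<open>auto simp: add.commute\<close>)
  qed (use s in simp)
  show "N = N'"
  proof (rule measure_eqI)
    fix E assume "E \<in> sets N"
    then have E: "E \<in> sets borel" using s by simp
    have "emeasure N E + emeasure P' E = emeasure N' E + emeasure P E" if "E \<in> sets borel" for E
      using eq[OF that] by (simp add: add.commute)
    then show "emeasure N E = emeasure N' E"
      by (intro antisym Jordan_parts_le[of N "- A" P N' P' E] Jordan_parts_le[of N' "- A'" P' N P E])
         (use A A' s E in auto)
  qed (use s in simp)
qed

lemma has_second_deriv_measure_unique:
  assumes L: "L-lipschitz_on UNIV f"
    and f: "has_second_deriv_measure f P N" "has_second_deriv_measure f P' N'"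
  shows "P = P'" "N = N'"
proof -
  have r: "signed_radon_measure P N" "signed_radon_measure P' N'"
    using f unfolding has_second_deriv_measure_def by auto
  then have s: "sets P = sets borel" "sets N = sets borel" "sets P' = sets borel" "sets N' = sets borel"
    unfolding signed_radon_measure_def by auto
  let ?E = "range (\<lambda>(a, b). {a<..<b::real})"
  have box_eq: "(\<lambda>(a, b). box a b) = (\<lambda>(a, b). {a<..<b::real})" by (auto simp: fun_eq_iff)
  \<comment> \<open>\<open>total_variation\<close> merely forms the sum of two measures here;
    \<open>P\<close> and \<open>N'\<close> belong to different decompositions.\<close>
  have "total_variation P N' = total_variation P' N"
  proof (rule measure_eqI_generator_eq[where E = ?E and \<Omega> = UNIV and A = "\<lambda>i. {- real i<..<real i}"])
    show "Int_stable ?E"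
    proof (rule Int_stableI)
      fix I I' assume "I \<in> ?E" "I' \<in> ?E"
      then obtain a b c d where "I = {a<..<b}" "I' = {c<..<d}" by auto
      then have "I \<inter> I' = {max a c<..<min b d}" by auto
      then show "I \<inter> I' \<in> ?E" by auto
    qed
    show "emeasure (total_variation P N') X = emeasure (total_variation P' N) X" if XE: "X \<in> ?E" for X
    proof -
      obtain a b where X: "X = {a<..<b}" using XE by auto
      show ?thesis
      proof (cases "a < b")
        case True
        then show ?thesis using second_deriv_interval[OF L f True] by (simp add: X emeasure_total_variation s)
      qed (simp add: X)
    qed
    show "sets (total_variation P N') = sigma_sets UNIV ?E" "sets (total_variation P' N) = sigma_sets UNIV ?E"
      unfolding sets_total_variation borel_eq_box box_eq by simp_all
    show "(\<Union>i. {- real i<..<real i}) = UNIV"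
    proof -
      have "\<exists>i. - real i < t \<and> t < real i" for t
        using reals_Archimedean2[of "\<bar>t\<bar>"] by (metis abs_less_iff minus_less_iff)
      then show ?thesis by auto
    qed
    show "emeasure (total_variation P N') {- real i<..<real i} \<noteq> \<infinity>" for i
    proof -
      have "emeasure M {- real i<..<real i} < \<infinity>" if "M \<in> {P, N'}" for M
      proof -
        have "emeasure M {- real i<..<real i} \<le> emeasure M {- real i..real i}"
          using that s by (intro emeasure_mono) auto
        also have "\<dots> < \<infinity>" using that r unfolding signed_radon_measure_def by auto
        finally show ?thesis .
      qed
      from this[of P] this[of N'] show ?thesis by (auto simp: emeasure_total_variation s)
    qed
  qed auto
  then have "emeasure P E + emeasure N' E = emeasure P' E + emeasure N E" if "E \<in> sets borel" for E
    using that by (metis emeasure_total_variation s)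
  then show "P = P'" "N = N'" using Jordan_parts_unique[OF r] by blast+
qed

section \<open>The weighted total variation as a sum of two integrals\<close>

lemma nn_integral_total_variation:
  assumes s: "sets P = sets borel" "sets N = sets borel"
    and g: "g \<in> borel_measurable borel"
  shows "(\<integral>\<^sup>+ x. g x \<partial>total_variation P N) = (\<integral>\<^sup>+ x. g x \<partial>P) + (\<integral>\<^sup>+ x. g x \<partial>N)"
  using g
proof (induction rule: borel_measurable_induct)
  note [measurable_cong] = s sets_total_variation[of P N]
  note [simp] = s sets_total_variation
  case (cong f g) then show ?case by (simp add: fun_eq_iff)
next
  case (set A)
  then show ?case using s by (simp add: sets_total_variation emeasure_total_variation)
next
  note [measurable_cong] = s sets_total_variation[of P N]
  case (mult u c) then show ?case by (simp add: nn_integral_cmult distrib_left)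
next
  note [measurable_cong] = s sets_total_variation[of P N]
  case (add u v) then show ?case by (simp add: nn_integral_add ac_simps)
next
  note [measurable_cong] = s sets_total_variation[of P N]
  case (seq U)
  have "(\<integral>\<^sup>+ x. (SUP i. U i) x \<partial>M) = (SUP i. \<integral>\<^sup>+ x. U i x \<partial>M)" if "sets M = sets borel" for M
  proof -
    have "U i \<in> borel_measurable M" for i
      using seq(1) measurable_cong_sets[OF that refl] by blast
    then show ?thesis using seq(3) nn_integral_monotone_convergence_SUP[of U M] by (simp add: image_comp)
  qed
  moreover have "incseq (\<lambda>i. \<integral>\<^sup>+ x. U i x \<partial>M)" for M
    using seq(3) by (auto simp: incseq_def le_fun_def intro!: nn_integral_mono)
  ultimately show ?case using seq by (simp add: s sets_total_variation ennreal_SUP_add)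
qed

lemma weighted_TV_eq:
  assumes L: "L-lipschitz_on UNIV f" and f: "has_second_deriv_measure f P N"
  shows "weighted_TV f = (\<integral>\<^sup>+ x. ennreal (sqrt (1 + x\<^sup>2)) \<partial>P) + (\<integral>\<^sup>+ x. ennreal (sqrt (1 + x\<^sup>2)) \<partial>N)"
proof -
  have s: "sets P = sets borel" "sets N = sets borel"
    using f unfolding has_second_deriv_measure_def signed_radon_measure_def by auto
  have "(THE M. \<exists>P N. has_second_deriv_measure f P N \<and> M = total_variation P N) = total_variation P N"
    using f has_second_deriv_measure_unique[OF L f] by (intro the_equality) blast+
  then have "weighted_TV f = (\<integral>\<^sup>+ x. ennreal (sqrt (1 + x\<^sup>2)) \<partial>total_variation P N)"
    unfolding weighted_TV_def using L f by auto
  also have "\<dots> = (\<integral>\<^sup>+ x. ennreal (sqrt (1 + x\<^sup>2)) \<partial>P) + (\<integral>\<^sup>+ x. ennreal (sqrt (1 + x\<^sup>2)) \<partial>N)"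
    by (rule nn_integral_total_variation[OF s]) simp
  finally show ?thesis .
qed

section \<open>Linear splines\<close>

text \<open>\<open>ennreal\<close> clips negative masses to 0, so \<open>atomic T c\<close> and
  \<open>atomic T (\<lambda>t. - c t)\<close> are the positive and the negative part of the signed
  measure with atoms \<open>c t\<close>. \<open>distr\<close> moves the measure from the power set
  of \<open>T\<close> to the Borel sets.\<close>

definition atomic :: "real set \<Rightarrow> (real \<Rightarrow> real) \<Rightarrow> real measure" where
  "atomic T c = distr (density (count_space T) (\<lambda>t. ennreal (c t))) borel (\<lambda>t. t)"

lemma sets_atomic [simp]: "sets (atomic T c) = sets borel"
  by (simp add: atomic_def)

lemma nn_integral_atomic:
  assumes "finite T" "g \<in> borel_measurable borel"
  shows "(\<integral>\<^sup>+ x. g x \<partial>atomic T c) = (\<Sum>t\<in>T. ennreal (c t) * g t)"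
proof -
  have "(\<integral>\<^sup>+ x. g x \<partial>atomic T c) = (\<integral>\<^sup>+ x. g x \<partial>density (count_space T) (\<lambda>t. ennreal (c t)))"
    unfolding atomic_def using assms by (subst nn_integral_distr) auto
  also have "\<dots> = (\<integral>\<^sup>+ x. ennreal (c x) * g x \<partial>count_space T)"
    by (subst nn_integral_density) auto
  finally show ?thesis using assms by (simp add: nn_integral_count_space_finite)
qed

lemma emeasure_atomic:
  assumes "finite T" "A \<in> sets borel"
  shows "emeasure (atomic T c) A = (\<Sum>t\<in>T \<inter> A. ennreal (c t))"
proof -
  have "emeasure (atomic T c) A = (\<integral>\<^sup>+ x. indicator A x \<partial>atomic T c)"
    using assms by simp
  also have "\<dots> = (\<Sum>t\<in>T. ennreal (c t) * indicator A t)"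
    using assms by (intro nn_integral_atomic) auto
  also have "\<dots> = (\<Sum>t\<in>T \<inter> A. ennreal (c t))"
    unfolding sum.inter_restrict[OF assms(1)] by (intro sum.cong) auto
  finally show ?thesis .
qed

lemma integral_atomic:
  fixes g :: "real \<Rightarrow> real"
  assumes "finite T" "g \<in> borel_measurable borel" "\<And>t. t \<in> T \<Longrightarrow> 0 \<le> c t"
  shows "(LINT x|atomic T c. g x) = (\<Sum>t\<in>T. c t * g t)"
proof -
  have "(LINT x|atomic T c. g x) = (LINT x|density (count_space T) (\<lambda>t. ennreal (c t)). g x)"
    unfolding atomic_def using assms by (subst integral_distr) auto
  also have "\<dots> = (LINT x|count_space T. c x * g x)"
    using assms(3) by (subst integral_density) (auto simp: AE_count_space)
  finally show ?thesis using assms by (simp add: lebesgue_integral_count_space_finite)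
qed

lemma signed_radon_measure_atomic:
  assumes "finite T"
  shows "signed_radon_measure (atomic T c) (atomic T (\<lambda>t. - c t))"
proof -
  define A where "A = {t \<in> T. 0 < c t}"
  have A: "finite A" using assms by (simp add: A_def)
  then have b: "A \<in> sets borel" by (simp add: finite_imp_closed)
  have "(\<Sum>t\<in>T \<inter> - A. ennreal (c t)) = 0" "(\<Sum>t\<in>T \<inter> A. ennreal (- c t)) = 0"
    by (auto intro!: sum.neutral simp: A_def not_less ennreal_neg)
  then have "emeasure (atomic T c) (- A) = 0" "emeasure (atomic T (\<lambda>t. - c t)) A = 0"
    using assms b by (simp_all add: emeasure_atomic)
  moreover have "emeasure (atomic T d) K < \<infinity>" if "compact K" for K d
    using that assms by (simp add: emeasure_atomic compact_imp_closed)
  ultimately show ?thesis unfolding signed_radon_measure_def using b by auto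
qed

text \<open>Makes \<open>integral_atomic\<close>, which asks for nonnegative masses, applicable to
  signed ones.\<close>

lemma atomic_max: "atomic T (\<lambda>t. max 0 (c t)) = atomic T c"
proof -
  have "ennreal (max 0 r) = ennreal r" for r by (simp add: max_def ennreal_neg)
  then show ?thesis by (simp add: atomic_def)
qed

section \<open>Test functions and the second derivative of a linear spline\<close>

lemma test_function_props:
  assumes "test_function \<phi>"
  obtains M where "\<And>x. M \<le> \<bar>x\<bar> \<Longrightarrow> \<phi> x = 0" "\<And>x. M \<le> \<bar>x\<bar> \<Longrightarrow> deriv \<phi> x = 0" "\<And>x. M \<le> \<bar>x\<bar> \<Longrightarrow> deriv (deriv \<phi>) x = 0"
    and "\<And>x. (\<phi> has_real_derivative deriv \<phi> x) (at x)"
    and "\<And>x. (deriv \<phi> has_real_derivative deriv (deriv \<phi>) x) (at x)"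
    and "\<And>x. isCont (deriv (deriv \<phi>)) x"
proof -
  have diff: "(deriv ^^ k) \<phi> differentiable (at x)" for k x
    using assms unfolding test_function_def by blast
  have D: "((deriv ^^ k) \<phi> has_real_derivative (deriv ^^ Suc k) \<phi> x) (at x)" for k x
    using diff[of k x] by (simp add: DERIV_deriv_iff_real_differentiable)
  have "bounded {x. \<phi> x \<noteq> 0}"
    using assms unfolding test_function_def by (meson bounded_closure_image bounded_subset closure_subset compact_imp_bounded)
  then obtain M where M: "\<And>x. \<phi> x \<noteq> 0 \<Longrightarrow> \<bar>x\<bar> \<le> M"
    unfolding bounded_iff by auto
  have vanish: "(deriv ^^ k) \<phi> x = 0" if "M < \<bar>x\<bar>" for k x
    using that
  proof (induction k arbitrary: x)
    case 0 then show ?case using M[of x] by auto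
  next
    case (Suc k)
    have "\<forall>\<^sub>F y in nhds x. M < \<bar>y\<bar>"
      using Suc.prems by (intro order_tendstoD(1)[of abs "\<bar>x\<bar>"] tendsto_intros filterlim_ident)
    then have "\<forall>\<^sub>F y in nhds x. (deriv ^^ k) \<phi> y = 0" by eventually_elim (rule Suc.IH)
    then have "((deriv ^^ k) \<phi> has_real_derivative 0) (at x)"
      by (subst DERIV_cong_ev[OF refl _ refl]) auto
    then show ?case by (simp add: DERIV_imp_deriv)
  qed
  show ?thesis
  proof (rule that[of "M + 1"])
    show "\<phi> x = 0" "deriv \<phi> x = 0" "deriv (deriv \<phi>) x = 0" if "M + 1 \<le> \<bar>x\<bar>" for x
      using vanish[of x 0] vanish[of x 1] vanish[of x 2] that by (auto simp: numeral_2_eq_2)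
    show "(\<phi> has_real_derivative deriv \<phi> x) (at x)" for x using D[of 0 x] by simp
    show "(deriv \<phi> has_real_derivative deriv (deriv \<phi>) x) (at x)" for x using D[of 1 x] by simp
    show "isCont (deriv (deriv \<phi>)) x" for x
      using D[of 2 x] DERIV_isCont by (force simp: numeral_2_eq_2)
  qed
qed

text \<open>Integration by parts, with antiderivatives
  \<open>(x - s) * deriv \<phi> x - \<phi> x\<close> and
  \<open>(A + B * x) * deriv \<phi> x - B * \<phi> x\<close>. Boundary terms at \<open>M\<close> and
  \<open>- M\<close> vanish; the only one left is \<open>\<phi> s\<close>, from the kink of the
  hinge.\<close>

lemma weak_deriv_hinge:
  assumes "test_function \<phi>"
  shows "integrable lborel (\<lambda>t. max 0 (t - s) * deriv (deriv \<phi>) t)"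
    and "(LINT t|lborel. max 0 (t - s) * deriv (deriv \<phi>) t) = \<phi> s"
    and "integrable lborel (\<lambda>t. (A + B * t) * deriv (deriv \<phi>) t)"
    and "(LINT t|lborel. (A + B * t) * deriv (deriv \<phi>) t) = 0"
proof -
  obtain M0 where M0: "\<And>x. M0 \<le> \<bar>x\<bar> \<Longrightarrow> \<phi> x = 0" "\<And>x. M0 \<le> \<bar>x\<bar> \<Longrightarrow> deriv \<phi> x = 0" "\<And>x. M0 \<le> \<bar>x\<bar> \<Longrightarrow> deriv (deriv \<phi>) x = 0"
    "\<And>x. (\<phi> has_real_derivative deriv \<phi> x) (at x)"
    "\<And>x. (deriv \<phi> has_real_derivative deriv (deriv \<phi>) x) (at x)"
    "\<And>x. isCont (deriv (deriv \<phi>)) x"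
    using test_function_props[OF assms] by metis
  define M where "M = max M0 \<bar>s\<bar> + 1"
  have M: "\<phi> x = 0" "deriv \<phi> x = 0" "deriv (deriv \<phi>) x = 0" if "M \<le> \<bar>x\<bar>" for x
    using M0(1-3)[of x] that by (auto simp: M_def)
  have "M > 0" "s \<le> M" by (auto simp: M_def)
  have M': "deriv (deriv \<phi>) x = 0" if "M < x \<or> x < - M" for x
    using that M(3)[of x] abs_ge_self[of x] abs_ge_minus_self[of x] by linarith
  have hinge: "has_bochner_integral lborel
      (\<lambda>x. ((x - s) * deriv (deriv \<phi>) x) * indicator {s..M} x)
      (((M - s) * deriv \<phi> M - \<phi> M) - ((s - s) * deriv \<phi> s - \<phi> s))"
    by (rule has_bochner_integral_FTC_Icc_real[where F = "\<lambda>x. (x - s) * deriv \<phi> x - \<phi> x"])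
       (use \<open>s \<le> M\<close> M0(6) in \<open>auto intro!: derivative_eq_intros M0 continuous_intros\<close>)
  have eq: "((x - s) * deriv (deriv \<phi>) x) * indicator {s..M} x = max 0 (x - s) * deriv (deriv \<phi>) x" for x
    using M'[of x] by (cases "x \<in> {s..M}") (auto simp: max_def)
  from hinge show "integrable lborel (\<lambda>t. max 0 (t - s) * deriv (deriv \<phi>) t)"
    "(LINT t|lborel. max 0 (t - s) * deriv (deriv \<phi>) t) = \<phi> s"
    unfolding eq using M[of M] \<open>M > 0\<close> by (auto simp: has_bochner_integral_iff)
  have affine: "has_bochner_integral lborel
      (\<lambda>x. ((A + B * x) * deriv (deriv \<phi>) x) * indicator {-M..M} x)
      (((A + B * M) * deriv \<phi> M - B * \<phi> M) - ((A + B * (-M)) * deriv \<phi> (-M) - B * \<phi> (-M)))"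
    by (rule has_bochner_integral_FTC_Icc_real[where F = "\<lambda>x. (A + B * x) * deriv \<phi> x - B * \<phi> x"])
       (use \<open>M > 0\<close> M0(6) in \<open>auto intro!: derivative_eq_intros M0 continuous_intros\<close>)
  have eq: "((A + B * x) * deriv (deriv \<phi>) x) * indicator {-M..M} x = (A + B * x) * deriv (deriv \<phi>) x" for x
    using M'[of x] by (cases "x \<in> {-M..M}") auto
  from affine show "integrable lborel (\<lambda>t. (A + B * t) * deriv (deriv \<phi>) t)"
    "(LINT t|lborel. (A + B * t) * deriv (deriv \<phi>) t) = 0"
    unfolding eq using M[of M] M[of "-M"] \<open>M > 0\<close> by (auto simp: has_bochner_integral_iff)
qed

definition linear_spline :: "real \<Rightarrow> real \<Rightarrow> real set \<Rightarrow> (real \<Rightarrow> real) \<Rightarrow> real \<Rightarrow> real" where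
  "linear_spline A B T c t = A + B * t + (\<Sum>s\<in>T. c s * max 0 (t - s))"

lemma linear_spline_lipschitz: "\<exists>L. L-lipschitz_on UNIV (linear_spline A B T c)"
proof -
  have "(\<bar>B\<bar> + (\<Sum>s\<in>T. \<bar>c s\<bar>))-lipschitz_on UNIV (linear_spline A B T c)"
  proof (rule lipschitz_onI)
    fix t u :: real
    have "linear_spline A B T c t - linear_spline A B T c u
        = B * (t - u) + (\<Sum>s\<in>T. c s * (max 0 (t - s) - max 0 (u - s)))"
      by (simp add: linear_spline_def sum_subtractf[symmetric] algebra_simps)
    also have "\<bar>\<dots>\<bar> \<le> \<bar>B\<bar> * \<bar>t - u\<bar> + (\<Sum>s\<in>T. \<bar>c s\<bar> * \<bar>t - u\<bar>)"
    proof (rule order_trans[OF abs_triangle_ineq add_mono])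
      have "\<bar>c s * (max 0 (t - s) - max 0 (u - s))\<bar> \<le> \<bar>c s\<bar> * \<bar>t - u\<bar>" for s
        unfolding abs_mult by (intro mult_left_mono) auto
      then show "\<bar>\<Sum>s\<in>T. c s * (max 0 (t - s) - max 0 (u - s))\<bar> \<le> (\<Sum>s\<in>T. \<bar>c s\<bar> * \<bar>t - u\<bar>)"
        by (intro order_trans[OF sum_abs] sum_mono)
    qed (simp add: abs_mult)
    finally show "dist (linear_spline A B T c t) (linear_spline A B T c u)
        \<le> (\<bar>B\<bar> + (\<Sum>s\<in>T. \<bar>c s\<bar>)) * dist t u"
      by (simp add: dist_real_def distrib_right sum_distrib_right)
  qed (auto intro: add_nonneg_nonneg sum_nonneg)
  then show ?thesis by blast
qed

lemma linear_spline_second_deriv: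
  assumes T: "finite T"
  shows "has_second_deriv_measure (linear_spline A B T c) (atomic T c) (atomic T (\<lambda>t. - c t))"
  unfolding has_second_deriv_measure_def
proof (intro conjI allI impI signed_radon_measure_atomic[OF T])
  fix \<phi> assume \<phi>: "test_function \<phi>"
  note h = weak_deriv_hinge[OF \<phi>]
  have "isCont \<phi> x" for x using test_function_props[OF \<phi>] by (metis DERIV_isCont)
  then have meas: "\<phi> \<in> borel_measurable borel"
    by (intro borel_measurable_continuous_onI continuous_at_imp_continuous_on) auto
  have "(LINT x|lborel. linear_spline A B T c x * deriv (deriv \<phi>) x)
      = (LINT x|lborel. (A + B * x) * deriv (deriv \<phi>) x + (\<Sum>s\<in>T. c s * (max 0 (x - s) * deriv (deriv \<phi>) x)))"
    unfolding linear_spline_def distrib_right[of "A + B * x" for x] sum_distrib_right mult.assoc ..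
  also have "\<dots> = (\<Sum>s\<in>T. c s * \<phi> s)"
    using h by (subst Bochner_Integration.integral_add) (auto simp: Bochner_Integration.integral_sum)
  also have "\<dots> = (\<Sum>s\<in>T. max 0 (c s) * \<phi> s) - (\<Sum>s\<in>T. max 0 (- c s) * \<phi> s)"
    unfolding sum_subtractf[symmetric] by (intro sum.cong) (auto simp: max_def)
  also have "\<dots> = (LINT x|atomic T c. \<phi> x) - (LINT x|atomic T (\<lambda>t. - c t). \<phi> x)"
    using integral_atomic[OF T meas, of "\<lambda>t. max 0 (c t)"] integral_atomic[OF T meas, of "\<lambda>t. max 0 (- c t)"]
    by (simp add: atomic_max)
  finally show "(LINT x|lborel. linear_spline A B T c x * deriv (deriv \<phi>) x)
      = (LINT x|atomic T c. \<phi> x) - (LINT x|atomic T (\<lambda>t. - c t). \<phi> x)" .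
qed

lemma weighted_TV_linear_spline:
  assumes T: "finite T"
  shows "weighted_TV (linear_spline A B T c) = ennreal (\<Sum>t\<in>T. \<bar>c t\<bar> * sqrt (1 + t\<^sup>2))"
proof -
  obtain L where L: "L-lipschitz_on UNIV (linear_spline A B T c)" using linear_spline_lipschitz by blast
  have "weighted_TV (linear_spline A B T c)
      = (\<Sum>t\<in>T. ennreal (c t) * ennreal (sqrt (1 + t\<^sup>2))) + (\<Sum>t\<in>T. ennreal (- c t) * ennreal (sqrt (1 + t\<^sup>2)))"
    unfolding weighted_TV_eq[OF L linear_spline_second_deriv[OF T]] using T by (simp add: nn_integral_atomic)
  also have "\<dots> = (\<Sum>t\<in>T. ennreal (\<bar>c t\<bar> * sqrt (1 + t\<^sup>2)))"
    unfolding sum.distrib[symmetric]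
  proof (intro sum.cong refl)
    fix t
    show "ennreal (c t) * ennreal (sqrt (1 + t\<^sup>2)) + ennreal (- c t) * ennreal (sqrt (1 + t\<^sup>2))
        = ennreal (\<bar>c t\<bar> * sqrt (1 + t\<^sup>2))"
      by (cases "0 \<le> c t") (simp_all add: ennreal_neg ennreal_mult[symmetric])
  qed
  finally show ?thesis by (simp add: sum_ennreal)
qed

section \<open>Hahn--Banach in finite dimension\<close>

definition sublinear :: "((nat \<Rightarrow> real) \<Rightarrow> real) \<Rightarrow> bool" where
  "sublinear p \<longleftrightarrow> (\<forall>u v. p (\<lambda>j. u j + v j) \<le> p u + p v) \<and> (\<forall>c>0. \<forall>v. p (\<lambda>j. c * v j) = c * p v)"

lemma sublinear_zero: assumes "sublinear p" shows "p (\<lambda>j. 0) = 0"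
proof -
  have "p (\<lambda>j. 2 * 0) = 2 * p (\<lambda>j. 0)"
    using assms[unfolded sublinear_def, THEN conjunct2, rule_format, of 2 "\<lambda>j. 0"] by simp
  then show ?thesis by simp
qed

lemma sublinear_neg: assumes "sublinear p" shows "- p (\<lambda>j. - v j) \<le> p v"
proof -
  have "p (\<lambda>j. v j + - v j) \<le> p v + p (\<lambda>j. - v j)"
    using assms[unfolded sublinear_def, THEN conjunct1, rule_format, of v "\<lambda>j. - v j"] .
  then show ?thesis using sublinear_zero[OF assms] by simp
qed

text \<open>One step of Hahn--Banach without a maximality argument: \<open>q v\<close> is the
  infimum over \<open>t \<ge> 0\<close> of \<open>p (\<lambda>j. v j + t * u j) - t * p u\<close>.
  Subadditivity bounds it below by \<open>- p (\<lambda>j. - v j)\<close>, \<open>t = 0\<close>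
  gives \<open>q v \<le> p v\<close>, and \<open>t = 1\<close> gives the upper bound at the negative
  of \<open>u\<close>.\<close>

lemma sublinear_odd_direction:
  assumes p: "sublinear p"
  obtains q where "sublinear q" "\<And>v. q v \<le> p v" "q (\<lambda>j. - u j) = - p u"
proof -
  define g where "g v t = p (\<lambda>j. v j + t * u j) - t * p u" for v t
  define q where "q v = (INF t\<in>{0..}. g v t)" for v
  have sub: "p (\<lambda>j. a j + b j) \<le> p a + p b" for a b
    using p unfolding sublinear_def by blast
  have hom: "p (\<lambda>j. c * a j) = c * p a" if "c \<ge> 0" for a c
    using p sublinear_zero[OF p] that unfolding sublinear_def by (cases "c = 0") auto
  have lb: "- p (\<lambda>j. - v j) \<le> g v t" if "t \<ge> 0" for v t
  proof -
    have "p (\<lambda>j. t * u j) \<le> p (\<lambda>j. v j + t * u j) + p (\<lambda>j. - v j)"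
      using sub[of "\<lambda>j. v j + t * u j" "\<lambda>j. - v j"] by simp
    then show ?thesis using hom[OF that, of u] by (simp add: g_def)
  qed
  have bdd: "bdd_below (g v ` {0..})" for v
    using lb by (intro bdd_belowI2[where m = "- p (\<lambda>j. - v j)"]) auto
  have qle: "q v \<le> g v t" if "t \<ge> 0" for v t
    unfolding q_def by (rule cINF_lower[OF bdd]) (use that in auto)
  have qge: "m \<le> q v" if "\<And>t. t \<ge> 0 \<Longrightarrow> m \<le> g v t" for v m
    unfolding q_def by (rule cINF_greatest) (use that in auto)
  have add: "q (\<lambda>j. a j + b j) \<le> q a + q b" for a b
  proof -
    have step: "q (\<lambda>j. a j + b j) - g a t \<le> g b s" if ts: "t \<ge> 0" "s \<ge> 0" for t s
    proof -
      have "q (\<lambda>j. a j + b j) \<le> g (\<lambda>j. a j + b j) (t + s)" using qle ts by simp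
      also have "\<dots> \<le> g a t + g b s"
        using sub[of "\<lambda>j. a j + t * u j" "\<lambda>j. b j + s * u j"]
        by (simp add: g_def algebra_simps)
      finally show ?thesis by simp
    qed
    have "q (\<lambda>j. a j + b j) - g a t \<le> q b" if "t \<ge> 0" for t
      using step that by (intro qge) auto
    then have "q (\<lambda>j. a j + b j) - q b \<le> g a t" if "t \<ge> 0" for t
      using that by force
    then have "q (\<lambda>j. a j + b j) - q b \<le> q a" by (intro qge) auto
    then show ?thesis by simp
  qed
  have half: "q (\<lambda>j. c * v j) \<le> c * q v" if "c > 0" for c v
  proof -
    have "q (\<lambda>j. c * v j) / c \<le> g v t" if t: "t \<ge> 0" for t
    proof -
      have "q (\<lambda>j. c * v j) \<le> g (\<lambda>j. c * v j) (c * t)" using qle t \<open>c > 0\<close> by simp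
      also have "\<dots> = c * g v t"
        using hom[of c "\<lambda>j. v j + t * u j"] \<open>c > 0\<close> by (simp add: g_def algebra_simps)
      finally show ?thesis using \<open>c > 0\<close> by (simp add: field_simps)
    qed
    then have "q (\<lambda>j. c * v j) / c \<le> q v" by (intro qge) auto
    then show ?thesis using that by (simp add: field_simps)
  qed
  have "q (\<lambda>j. c * v j) = c * q v" if "c > 0" for c v
  proof (rule antisym)
    have "q v \<le> (1 / c) * q (\<lambda>j. c * v j)"
      using half[of "1 / c" "\<lambda>j. c * v j"] that by simp
    then show "c * q v \<le> q (\<lambda>j. c * v j)" using that by (simp add: field_simps)
  qed (use half that in auto)
  with add have "sublinear q" unfolding sublinear_def by blast
  moreover have "q v \<le> p v" for v using qle[of 0 v] by (simp add: g_def)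
  moreover have "q (\<lambda>j. - u j) = - p u"
  proof (rule antisym)
    show "q (\<lambda>j. - u j) \<le> - p u"
      using qle[of 1 "\<lambda>j. - u j"] sublinear_zero[OF p] by (simp add: g_def)
    show "- p u \<le> q (\<lambda>j. - u j)" using lb[of _ "\<lambda>j. - u j"] by (intro qge) simp
  qed
  ultimately show ?thesis using that by blast
qed

text \<open>Directions in which a functional is already odd survive any further decrease, so the
  coordinates can be treated one at a time.\<close>

lemma sublinear_odd_mono:
  assumes "sublinear q" "\<And>v. q v \<le> p v" "p (\<lambda>j. - u j) = - p u"
  shows "q (\<lambda>j. - u j) = - q u" "q u = p u"
proof -
  have "- q (\<lambda>j. - u j) \<le> q u" by (rule sublinear_neg[OF assms(1)])
  moreover have "q u \<le> p u" "q (\<lambda>j. - u j) \<le> p (\<lambda>j. - u j)" using assms(2) by auto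
  ultimately show "q (\<lambda>j. - u j) = - q u" "q u = p u" using assms(3) by linarith+
qed

lemma sublinear_odd_directions:
  assumes "finite U" "sublinear p"
  shows "\<exists>q. sublinear q \<and> (\<forall>v. q v \<le> p v) \<and> (\<forall>u\<in>U. q (\<lambda>j. - u j) = - q u)"
  using assms
proof (induction U)
  case empty then show ?case by auto
next
  case (insert u U)
  then obtain q where q: "sublinear q" "\<And>v. q v \<le> p v" "\<forall>u\<in>U. q (\<lambda>j. - u j) = - q u" by blast
  obtain r where r: "sublinear r" "\<And>v. r v \<le> q v" "r (\<lambda>j. - u j) = - q u"
    using sublinear_odd_direction[OF q(1)] by blast
  have "r (\<lambda>j. - w j) = - r w" if "w \<in> U" for w
    using sublinear_odd_mono[OF r(1,2)] q(3) that by blast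
  moreover have "r (\<lambda>j. - u j) = - r u"
    using r(2)[of u] r(3) sublinear_neg[OF r(1), of u] by linarith
  moreover have "r v \<le> p v" for v using r(2)[of v] q(2)[of v] by linarith
  ultimately show ?case using r(1) by blast
qed

text \<open>The direction \<open>y\<close> is treated first, which pins the value at
  \<open>y\<close> to \<open>p y\<close> for every smaller sublinear functional. Then the unit
  vectors are made odd, and a sublinear functional that is odd along a basis is linear.\<close>

lemma finite_Hahn_Banach:
  assumes p: "sublinear p" and J: "finite J"
    and loc: "\<And>u v. (\<And>j. j \<in> J \<Longrightarrow> u j = v j) \<Longrightarrow> p u = p v"
  obtains k where "\<And>v. (\<Sum>j\<in>J. k j * v j) \<le> p v" "(\<Sum>j\<in>J. k j * y j) = p y"
proof -
  \<comment> \<open>\<open>loc\<close> makes \<open>p\<close> blind to coordinates outside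
    \<open>J\<close>; setting them to 0 puts \<open>y'\<close> into the span of the unit vectors
    \<open>e j\<close> with \<open>j \<in> J\<close>.\<close>
  define y' where "y' j = (if j \<in> J then y j else 0)" for j
  have y': "p y' = p y" by (rule loc) (simp add: y'_def)
  obtain q0 where q0: "sublinear q0" "\<And>v. q0 v \<le> p v" "q0 (\<lambda>j. - y' j) = - p y'"
    using sublinear_odd_direction[OF p] by blast
  define e where "e i = (\<lambda>j::nat. if j = i then 1 else (0::real))" for i
  obtain q where q: "sublinear q" "\<And>v. q v \<le> q0 v" "\<forall>u\<in>e ` J. q (\<lambda>j. - u j) = - q u"
    using sublinear_odd_directions[of "e ` J", OF _ q0(1)] J by blast
  have sub: "q (\<lambda>j. a j + b j) \<le> q a + q b" for a b
    using q(1) unfolding sublinear_def by blast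
  have hom: "q (\<lambda>j. c * a j) = c * q a" if "c > 0" for a c
    using q(1) that unfolding sublinear_def by blast
  have coord: "q (\<lambda>j. c * e i j) = c * q (e i)" if "i \<in> J" for c i
  proof (cases c "0::real" rule: linorder_cases)
    case less
    then have "q (\<lambda>j. (- c) * (- e i j)) = (- c) * q (\<lambda>j. - e i j)"
      by (intro hom) simp
    then show ?thesis using q(3) that by simp
  next
    case equal then show ?thesis using sublinear_zero[OF q(1)] by simp
  next
    case greater then show ?thesis by (rule hom)
  qed
  have lin: "q (\<lambda>j. a j + c * e i j) = q a + c * q (e i)" if "i \<in> J" for a c i
  proof (rule antisym)
    show "q (\<lambda>j. a j + c * e i j) \<le> q a + c * q (e i)"
      using sub[of a "\<lambda>j. c * e i j"] coord[OF that, of c] by simp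
    show "q a + c * q (e i) \<le> q (\<lambda>j. a j + c * e i j)"
      using sub[of "\<lambda>j. a j + c * e i j" "\<lambda>j. (- c) * e i j"] coord[OF that, of "- c"]
      by simp
  qed
  have tot: "q (\<lambda>j. if j \<in> F then v j else 0) = (\<Sum>j\<in>F. q (e j) * v j)"
    if "finite F" "F \<subseteq> J" for F v using that
  proof (induction F)
    case empty show ?case using sublinear_zero[OF q(1)] by simp
  next
    case (insert i F)
    have "(\<lambda>j. if j \<in> insert i F then v j else 0) = (\<lambda>j. (if j \<in> F then v j else 0) + v i * e i j)"
      using insert.hyps(2) by (auto simp: e_def)
    then have "q (\<lambda>j. if j \<in> insert i F then v j else 0)
        = q (\<lambda>j. if j \<in> F then v j else 0) + v i * q (e i)"
      using lin insert.prems by simp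
    then show ?case using insert by (simp add: algebra_simps)
  qed
  show ?thesis
  proof
    show le: "(\<Sum>j\<in>J. q (e j) * v j) \<le> p v" for v
    proof -
      have "q (\<lambda>j. if j \<in> J then v j else 0) \<le> p (\<lambda>j. if j \<in> J then v j else 0)"
        using q(2) q0(2) order_trans by blast
      also have "\<dots> = p v" by (rule loc) simp
      finally show ?thesis using tot[OF J, of v] by simp
    qed
    have "p y \<le> - q (\<lambda>j. - y' j)"
      using q(2)[of "\<lambda>j. - y' j"] q0(3) y' by linarith
    also have "\<dots> \<le> q y'" by (rule sublinear_neg[OF q(1)])
    also have "\<dots> = (\<Sum>j\<in>J. q (e j) * y j)"
      using tot[OF J, of y] unfolding y'_def by simp
    finally show "(\<Sum>j\<in>J. q (e j) * y j) = p y" using le[of y] by simp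
  qed
qed

section \<open>Duality for finitely many knots\<close>

text \<open>A complex number \<open>z\<close> encodes an atom by its mass \<open>Re z\<close> and first moment \<open>Im z\<close>; it sits
  at \<open>Im z / Re z\<close>, and \<open>cmod z\<close> is its weighted mass. The components of \<open>\<theta> i\<close> are the positive and
  the negative atom in the \<open>i\<close>-th interval.\<close>

definition knot_cone :: "(nat \<Rightarrow> real) \<Rightarrow> nat \<Rightarrow> complex set" where
  "knot_cone x i = {z. 0 \<le> Re z \<and> x i * Re z \<le> Im z \<and> Im z \<le> x (Suc i) * Re z}"

text \<open>The value at \<open>x j\<close> of the hinges at the encoded knots. Intervals
  \<open>i < j\<close> lie to the left of \<open>x j\<close>, where a hinge of mass \<open>m\<close>
  at \<open>t\<close> contributes \<open>m * x j - m * t\<close>; the others contribute 0. So the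
  sum is linear in mass and moment and never mentions the position.\<close>

definition knot_sum :: "(nat \<Rightarrow> real) \<Rightarrow> (nat \<Rightarrow> complex \<times> complex) \<Rightarrow> nat \<Rightarrow> real" where
  "knot_sum x \<theta> j = (\<Sum>i\<in>{1..<j}. Re (fst (\<theta> i) - snd (\<theta> i)) * x j - Im (fst (\<theta> i) - snd (\<theta> i)))"

definition knot_cost :: "nat \<Rightarrow> (nat \<Rightarrow> complex \<times> complex) \<Rightarrow> real" where
  "knot_cost n \<theta> = (\<Sum>i\<in>{1..<n}. cmod (fst (\<theta> i)) + cmod (snd (\<theta> i)))"

definition knots_fit :: "nat \<Rightarrow> (nat \<Rightarrow> real) \<Rightarrow> (nat \<Rightarrow> real) \<Rightarrow> (nat \<Rightarrow> complex \<times> complex) \<Rightarrow> bool" where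
  "knots_fit n x v \<theta> \<longleftrightarrow>
     (\<forall>i\<in>{1..<n}. fst (\<theta> i) \<in> knot_cone x i \<and> snd (\<theta> i) \<in> knot_cone x i) \<and>
     (\<exists>A B. \<forall>j\<in>{1..n}. v j = A + B * x j + knot_sum x \<theta> j)"

text \<open>Interpolation with knots at \<open>x 1\<close> up to \<open>x (n - 1)\<close> is a
  triangular system: the hinge at \<open>x m\<close> is 0 at the nodes up to \<open>x m\<close>, so
  the coefficients can be chosen from left to right.\<close>

lemma knots_fit_exists:
  assumes x: "strict_mono_on {1..n} x"
  shows "\<exists>\<theta>. knots_fit n x v \<theta>"
proof -
  have "\<exists>c. \<forall>j\<in>{1..m}. v j = v 1 + (\<Sum>i\<in>{1..<j}. c i * (x j - x i))" if "m \<le> n" for m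
    using that
  proof (induction m)
    case 0 then show ?case by simp
  next
    case (Suc m)
    then obtain c where c: "\<And>j. j \<in> {1..m} \<Longrightarrow> v j = v 1 + (\<Sum>i\<in>{1..<j}. c i * (x j - x i))"
      by (meson Suc_leD)
    show ?case
    proof (cases "m = 0")
      case True then show ?thesis by auto
    next
      case False
      then have less: "x m < x (Suc m)"
        using Suc.prems by (intro strict_mono_onD[OF x]) auto
      define S where "S = (\<Sum>i\<in>{1..<m}. c i * (x (Suc m) - x i))"
      define c' where "c' = c(m := (v (Suc m) - v 1 - S) / (x (Suc m) - x m))"
      have old: "(\<Sum>i\<in>{1..<j}. c' i * (x k - x i)) = (\<Sum>i\<in>{1..<j}. c i * (x k - x i))" if "j \<le> m" for j k
        using that by (intro sum.cong) (auto simp: c'_def)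
      have new: "(\<Sum>i\<in>{1..<Suc m}. c' i * (x (Suc m) - x i)) = v (Suc m) - v 1"
        using False less old[of m "Suc m"] by (simp add: S_def c'_def)
      have "v j = v 1 + (\<Sum>i\<in>{1..<j}. c' i * (x j - x i))" if "j \<in> {1..Suc m}" for j
      proof (cases "j = Suc m")
        case True
        then show ?thesis using new by (simp only:)
      next
        case False
        then have "j \<in> {1..m}" using that by auto
        then show ?thesis using c[of j] old[of j j] by simp
      qed
      then show ?thesis by blast
    qed
  qed
  then obtain c where c: "\<And>j. j \<in> {1..n} \<Longrightarrow> v j = v 1 + (\<Sum>i\<in>{1..<j}. c i * (x j - x i))"
    by blast
  \<comment> \<open>A signed coefficient becomes a positive or a negative atom at the left end of
    interval \<open>i\<close>.\<close>
  define \<theta> where "\<theta> i = (of_real (max 0 (c i)) * Complex 1 (x i), of_real (max 0 (- c i)) * Complex 1 (x i))" for i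
  have "x i * max 0 r \<le> x (Suc i) * max 0 r" if "i \<in> {1..<n}" for i r
    using strict_mono_onD[OF x, of i "Suc i"] that by (intro mult_right_mono) auto
  then have cone: "fst (\<theta> i) \<in> knot_cone x i \<and> snd (\<theta> i) \<in> knot_cone x i" if "i \<in> {1..<n}" for i
    using that by (simp add: knot_cone_def \<theta>_def mult.commute[of "max 0 r" for r])
  have d: "Re (fst (\<theta> i) - snd (\<theta> i)) = c i" "Im (fst (\<theta> i) - snd (\<theta> i)) = c i * x i" for i
    by (auto simp: \<theta>_def max_def algebra_simps)
  have "knot_sum x \<theta> j = (\<Sum>i\<in>{1..<j}. c i * (x j - x i))" for j
    unfolding knot_sum_def d by (simp add: algebra_simps)
  with c have "\<forall>j\<in>{1..n}. v j = v 1 + 0 * x j + knot_sum x \<theta> j"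
    by (metis add.right_neutral mult_zero_left)
  then show ?thesis unfolding knots_fit_def using cone by blast
qed

text \<open>The affine part is eliminated through the first two nodes, as
  \<open>knot_sum x \<theta> 1 = 0\<close>. Without the existential quantifier the condition is
  visibly closed in \<theta>, which \<open>knots_fit_min\<close> needs.\<close>

lemma knots_fit_iff:
  assumes "2 \<le> n" "x 1 < x 2"
  shows "knots_fit n x v \<theta> \<longleftrightarrow>
     (\<forall>i\<in>{1..<n}. fst (\<theta> i) \<in> knot_cone x i \<and> snd (\<theta> i) \<in> knot_cone x i) \<and>
     (\<forall>j\<in>{1..n}. v j = v 1 + (v 2 - v 1 - knot_sum x \<theta> 2) / (x 2 - x 1) * (x j - x 1) + knot_sum x \<theta> j)"
    (is "_ \<longleftrightarrow> ?C \<and> ?E")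
proof -
  have "?E \<longleftrightarrow> (\<exists>A B. \<forall>j\<in>{1..n}. v j = A + B * x j + knot_sum x \<theta> j)"
  proof
    assume E: ?E
    define B where "B = (v 2 - v 1 - knot_sum x \<theta> 2) / (x 2 - x 1)"
    have "\<forall>j\<in>{1..n}. v j = (v 1 - B * x 1) + B * x j + knot_sum x \<theta> j"
      using E unfolding B_def[symmetric] by (simp add: algebra_simps)
    then show "\<exists>A B. \<forall>j\<in>{1..n}. v j = A + B * x j + knot_sum x \<theta> j" by blast
  next
    assume "\<exists>A B. \<forall>j\<in>{1..n}. v j = A + B * x j + knot_sum x \<theta> j"
    then obtain A B where AB: "\<And>j. j \<in> {1..n} \<Longrightarrow> v j = A + B * x j + knot_sum x \<theta> j" by blast
    have 1: "v 1 = A + B * x 1" using AB[of 1] assms by (simp add: knot_sum_def)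
    have "v 2 = A + B * x 2 + knot_sum x \<theta> 2" using AB[of 2] assms by simp
    with 1 have "v 2 - v 1 - knot_sum x \<theta> 2 = B * (x 2 - x 1)" by (simp add: algebra_simps)
    then have "(v 2 - v 1 - knot_sum x \<theta> 2) / (x 2 - x 1) = B" using assms by simp
    then show ?E using AB 1 by (simp add: algebra_simps)
  qed
  then show ?thesis unfolding knots_fit_def by blast
qed

lemma compact_Pi_UNIV:
  fixes S :: "'a \<Rightarrow> 'b::topological_space set"
  assumes "\<And>i. compact (S i)"
  shows "compact (PiE UNIV S)"
proof -
  have "compactin (product_topology (\<lambda>i. euclidean) UNIV) (PiE UNIV S)"
    using assms by (simp add: compactin_PiE)
  then show ?thesis by (simp add: euclidean_product_topology)
qed

text \<open>The cost bounds every component in \<open>{1..<n}\<close>, and the components outside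
  can be set to 0. So all candidates no worse than a given feasible point lie in a product of
  compact sets, compact by Tychonoff's theorem.\<close>

lemma knots_fit_min:
  assumes n: "2 \<le> n" and x: "strict_mono_on {1..n} x"
  obtains \<theta> where "knots_fit n x v \<theta>" "\<And>\<theta>'. knots_fit n x v \<theta>' \<Longrightarrow> knot_cost n \<theta> \<le> knot_cost n \<theta>'"
proof -
  have x12: "x 1 < x 2" using n by (intro strict_mono_onD[OF x]) auto
  note fit = knots_fit_iff[of n x, OF n x12]
  obtain \<theta>0 where \<theta>0: "knots_fit n x v \<theta>0" using knots_fit_exists[OF x] by blast
  define M where "M = knot_cost n \<theta>0"
  define K where "K = PiE UNIV (\<lambda>i. if i \<in> {1..<n} then cball 0 M \<times> cball 0 M else {0::complex \<times> complex})"
  define F where "F = {\<theta>. knots_fit n x v \<theta>}"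
  define trunc where "trunc \<theta> i = (if i \<in> {1..<n} then \<theta> i else 0)" for \<theta> :: "nat \<Rightarrow> complex \<times> complex" and i
  have "compact K" unfolding K_def by (intro compact_Pi_UNIV) (auto intro: compact_Times)
  moreover have "closed F"
  proof -
    have [continuous_intros]: "continuous_on UNIV (\<lambda>\<theta>::nat \<Rightarrow> complex \<times> complex. \<theta> i)" for i
      by simp
    have [continuous_intros]: "continuous_on UNIV (\<lambda>\<theta>. knot_sum x \<theta> j)" for j
      unfolding knot_sum_def by (intro continuous_intros)
    show ?thesis unfolding F_def fit knot_cone_def mem_Collect_eq Ball_def
      by (intro closed_Collect_conj closed_Collect_all closed_Collect_imp closed_Collect_le
          closed_Collect_eq continuous_intros open_Collect_const) (use x12 in auto)
  qed
  ultimately have cpt: "compact (K \<inter> F)" by blast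
  have trunc: "knots_fit n x v (trunc \<theta>)" "knot_cost n (trunc \<theta>) = knot_cost n \<theta>"
    if "knots_fit n x v \<theta>" for \<theta>
  proof -
    have "knot_sum x (trunc \<theta>) j = knot_sum x \<theta> j" if "j \<in> {1..n}" for j
      unfolding knot_sum_def using that by (intro sum.cong) (auto simp: trunc_def)
    then show "knots_fit n x v (trunc \<theta>)"
      using that unfolding knots_fit_def by (simp add: trunc_def)
    show "knot_cost n (trunc \<theta>) = knot_cost n \<theta>"
      unfolding knot_cost_def by (intro sum.cong) (auto simp: trunc_def)
  qed
  have bnd: "trunc \<theta> \<in> K" if "knot_cost n \<theta> \<le> M" for \<theta>
  proof -
    have "cmod (fst (\<theta> i)) \<le> M \<and> cmod (snd (\<theta> i)) \<le> M" if i: "i \<in> {1..<n}" for i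
    proof -
      have "cmod (fst (\<theta> i)) + cmod (snd (\<theta> i)) \<le> knot_cost n \<theta>"
        unfolding knot_cost_def
        by (rule member_le_sum[OF i, of "\<lambda>i. cmod (fst (\<theta> i)) + cmod (snd (\<theta> i))"]) auto
      then show ?thesis using \<open>knot_cost n \<theta> \<le> M\<close> norm_ge_zero[of "fst (\<theta> i)"] norm_ge_zero[of "snd (\<theta> i)"]
        by linarith
    qed
    then show ?thesis by (auto simp: K_def PiE_def Pi_def trunc_def mem_Times_iff)
  qed
  have "continuous_on (K \<inter> F) (knot_cost n)"
  proof -
    have [continuous_intros]: "continuous_on UNIV (\<lambda>\<theta>::nat \<Rightarrow> complex \<times> complex. \<theta> i)" for i
      by simp
    have "continuous_on UNIV (knot_cost n)"
      unfolding knot_cost_def by (intro continuous_intros)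
    then show ?thesis by (rule continuous_on_subset) simp
  qed
  moreover have "trunc \<theta>0 \<in> K \<inter> F" using bnd[of \<theta>0] trunc[OF \<theta>0] by (simp add: M_def F_def)
  ultimately obtain \<theta> where \<theta>: "\<theta> \<in> K \<inter> F" "\<And>\<theta>'. \<theta>' \<in> K \<inter> F \<Longrightarrow> knot_cost n \<theta> \<le> knot_cost n \<theta>'"
    using continuous_attains_inf[OF cpt, of "knot_cost n"] by blast
  show ?thesis
  proof
    show "knots_fit n x v \<theta>" using \<theta>(1) by (simp add: F_def)
    have le: "knot_cost n \<theta> \<le> M"
      using \<theta>(2)[OF \<open>trunc \<theta>0 \<in> K \<inter> F\<close>] trunc(2)[OF \<theta>0] by (simp add: M_def)
    show "knot_cost n \<theta> \<le> knot_cost n \<theta>'" if "knots_fit n x v \<theta>'" for \<theta>'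
    proof (cases "knot_cost n \<theta>' \<le> M")
      case True
      then have "trunc \<theta>' \<in> K \<inter> F" using bnd trunc[OF that] by (simp add: F_def)
      from \<theta>(2)[OF this] show ?thesis using trunc(2)[OF that] by simp
    qed (use le in simp)
  qed
qed

section \<open>The optimal value as a sublinear function of the data\<close>

definition knot_value :: "nat \<Rightarrow> (nat \<Rightarrow> real) \<Rightarrow> (nat \<Rightarrow> real) \<Rightarrow> real" where
  "knot_value n x v = (INF \<theta>\<in>{\<theta>. knots_fit n x v \<theta>}. knot_cost n \<theta>)"

lemma knot_cost_nonneg: "0 \<le> knot_cost n \<theta>"
  unfolding knot_cost_def by (intro sum_nonneg) simp

lemma knot_value_le: "knots_fit n x v \<theta> \<Longrightarrow> knot_value n x v \<le> knot_cost n \<theta>"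
  unfolding knot_value_def
  by (rule cINF_lower) (auto intro!: bdd_belowI2[where m = 0] knot_cost_nonneg)

lemma knot_value_attained:
  assumes "2 \<le> n" "strict_mono_on {1..n} x"
  obtains \<theta> where "knots_fit n x v \<theta>" "knot_cost n \<theta> = knot_value n x v"
proof -
  obtain \<theta> where \<theta>: "knots_fit n x v \<theta>" "\<And>\<theta>'. knots_fit n x v \<theta>' \<Longrightarrow> knot_cost n \<theta> \<le> knot_cost n \<theta>'"
    using knots_fit_min[OF assms] by blast
  have "knot_cost n \<theta> \<le> knot_value n x v"
    unfolding knot_value_def by (rule cINF_greatest) (use \<theta> in auto)
  then show ?thesis using that \<theta>(1) knot_value_le[OF \<theta>(1)] by simp
qed

lemma knots_fit_add:
  assumes "knots_fit n x u \<theta>" "knots_fit n x v \<eta>"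
  shows "knots_fit n x (\<lambda>j. u j + v j) (\<lambda>i. \<theta> i + \<eta> i)"
proof -
  have s: "knot_sum x (\<lambda>i. \<theta> i + \<eta> i) j = knot_sum x \<theta> j + knot_sum x \<eta> j" for j
    unfolding knot_sum_def sum.distrib[symmetric] by (intro sum.cong) (auto simp: algebra_simps)
  obtain A B A' B' where AB: "\<And>j. j \<in> {1..n} \<Longrightarrow> u j = A + B * x j + knot_sum x \<theta> j"
      "\<And>j. j \<in> {1..n} \<Longrightarrow> v j = A' + B' * x j + knot_sum x \<eta> j"
    using assms unfolding knots_fit_def by metis
  have "\<forall>j\<in>{1..n}. u j + v j = (A + A') + (B + B') * x j + knot_sum x (\<lambda>i. \<theta> i + \<eta> i) j"
    using AB by (simp add: s distrib_right)
  moreover have "\<forall>i\<in>{1..<n}. fst (\<theta> i + \<eta> i) \<in> knot_cone x i \<and> snd (\<theta> i + \<eta> i) \<in> knot_cone x i"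
    using assms by (simp add: knots_fit_def knot_cone_def distrib_left add_mono)
  ultimately show ?thesis unfolding knots_fit_def by blast
qed

lemma knots_fit_scale:
  assumes "knots_fit n x v \<theta>" "0 \<le> c"
  shows "knots_fit n x (\<lambda>j. c * v j) (\<lambda>i. c *\<^sub>R \<theta> i)" "knot_cost n (\<lambda>i. c *\<^sub>R \<theta> i) = c * knot_cost n \<theta>"
proof -
  have s: "knot_sum x (\<lambda>i. c *\<^sub>R \<theta> i) j = c * knot_sum x \<theta> j" for j
    unfolding knot_sum_def sum_distrib_left by (intro sum.cong) (auto simp: algebra_simps)
  obtain A B where AB: "\<And>j. j \<in> {1..n} \<Longrightarrow> v j = A + B * x j + knot_sum x \<theta> j"
    using assms unfolding knots_fit_def by metis
  have "\<forall>j\<in>{1..n}. c * v j = c * A + c * B * x j + knot_sum x (\<lambda>i. c *\<^sub>R \<theta> i) j"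
    using AB by (simp add: s algebra_simps)
  moreover have "c *\<^sub>R z \<in> knot_cone x i" if "z \<in> knot_cone x i" for z i
    using that mult_left_mono[OF _ \<open>0 \<le> c\<close>, of "x i * Re z" "Im z"]
      mult_left_mono[OF _ \<open>0 \<le> c\<close>, of "Im z" "x (Suc i) * Re z"] \<open>0 \<le> c\<close>
    by (simp add: knot_cone_def mult.left_commute)
  ultimately show "knots_fit n x (\<lambda>j. c * v j) (\<lambda>i. c *\<^sub>R \<theta> i)"
    using assms(1) unfolding knots_fit_def by auto
  show "knot_cost n (\<lambda>i. c *\<^sub>R \<theta> i) = c * knot_cost n \<theta>"
    using assms(2) by (simp add: knot_cost_def sum_distrib_left distrib_left)
qed

lemma sublinear_knot_value:
  assumes "2 \<le> n" "strict_mono_on {1..n} x"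
  shows "sublinear (knot_value n x)"
proof -
  have "knot_value n x (\<lambda>j. u j + v j) \<le> knot_value n x u + knot_value n x v" for u v
  proof -
    obtain \<theta> where \<theta>: "knots_fit n x u \<theta>" "knot_cost n \<theta> = knot_value n x u"
      using knot_value_attained[OF assms] by blast
    obtain \<eta> where \<eta>: "knots_fit n x v \<eta>" "knot_cost n \<eta> = knot_value n x v"
      using knot_value_attained[OF assms] by blast
    have "knot_value n x (\<lambda>j. u j + v j) \<le> knot_cost n (\<lambda>i. \<theta> i + \<eta> i)"
      by (intro knot_value_le knots_fit_add \<theta> \<eta>)
    also have "\<dots> \<le> knot_cost n \<theta> + knot_cost n \<eta>"
    proof -
      have "cmod (fst (\<theta> i + \<eta> i)) + cmod (snd (\<theta> i + \<eta> i))
          \<le> (cmod (fst (\<theta> i)) + cmod (snd (\<theta> i))) + (cmod (fst (\<eta> i)) + cmod (snd (\<eta> i)))" for i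
        using norm_triangle_ineq[of "fst (\<theta> i)" "fst (\<eta> i)"] norm_triangle_ineq[of "snd (\<theta> i)" "snd (\<eta> i)"]
        by simp
      then show ?thesis unfolding knot_cost_def sum.distrib[symmetric] by (intro sum_mono)
    qed
    finally show ?thesis using \<theta> \<eta> by simp
  qed
  moreover have "knot_value n x (\<lambda>j. c * v j) = c * knot_value n x v" if "c > 0" for c v
  proof -
    have le: "knot_value n x (\<lambda>j. c * v j) \<le> c * knot_value n x v" if "c > 0" for c v
    proof -
      obtain \<theta> where \<theta>: "knots_fit n x v \<theta>" "knot_cost n \<theta> = knot_value n x v"
        using knot_value_attained[OF assms] by blast
      show ?thesis using knot_value_le[OF knots_fit_scale(1)[OF \<theta>(1)], of c] that
          knots_fit_scale(2)[OF \<theta>(1), of c] \<theta>(2) by simp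
    qed
    have "knot_value n x v \<le> (1 / c) * knot_value n x (\<lambda>j. c * v j)"
      using le[of "1 / c" "\<lambda>j. c * v j"] that by simp
    then show ?thesis using le[OF that, of v] that by (simp add: field_simps)
  qed
  ultimately show ?thesis unfolding sublinear_def by blast
qed

lemma node_interval:
  assumes n: "2 \<le> n" and t: "x 1 \<le> t" "t \<le> x n"
  obtains i where "i \<in> {1..<n}" "x i \<le> (t::real)" "t \<le> x (Suc i)"
proof -
  have "\<exists>i\<in>{1..<m}. x i \<le> t \<and> t \<le> x (Suc i)" if "2 \<le> m" "t \<le> x m" for m
    using that
  proof (induction m rule: nat_induct_at_least)
    case base
    then show ?case using t by (force simp: numeral_2_eq_2)
  next
    case (Suc m)
    show ?case
    proof (cases "t \<le> x m")
      case True
      with Suc.IH obtain i where "i \<in> {1..<m}" "x i \<le> t" "t \<le> x (Suc i)" by blast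
      then show ?thesis by (intro bexI[of _ i]) auto
    next
      case False
      then show ?thesis using Suc by (intro bexI[of _ m]) auto
    qed
  qed
  then show ?thesis using that n t(2) by blast
qed

text \<open>Tested on the data \<open>max 0 (x j - t)\<close>, a functional \<open>k\<close> returns
  the certificate at \<open>t\<close>. One unit atom at \<open>t\<close> fits them at cost
  \<open>sqrt (1 + t\<^sup>2)\<close>; the two signs yield the two sides of the bound on the
  certificate.\<close>

lemma knots_fit_hinge:
  assumes x: "strict_mono_on {1..n} x" and i: "i \<in> {1..<n}" and t: "x i \<le> t" "t \<le> x (Suc i)"
  shows "knots_fit n x (\<lambda>j. max 0 (x j - t)) (\<lambda>k. if k = i then (Complex 1 t, 0) else 0)"
    and "knots_fit n x (\<lambda>j. - max 0 (x j - t)) (\<lambda>k. if k = i then (0, Complex 1 t) else 0)"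
proof -
  have mono: "x j \<le> x k" if "j \<in> {1..n}" "k \<in> {1..n}" "j \<le> k" for j k
    using that strict_mono_on_leD[OF x] by blast
  have pos: "max 0 (x j - t) = (if i < j then x j - t else 0)" if "j \<in> {1..n}" for j
    using mono[of "Suc i" j] mono[of j i] that i t by auto
  have s: "(\<Sum>k\<in>{1..<j}. if k = i then r else 0) = (if i < j then r else 0)" for j and r :: real
    using i by simp
  define \<theta> \<theta>' where "\<theta> = (\<lambda>k. if k = i then (Complex 1 t, 0) else (0::complex \<times> complex))"
    and "\<theta>' = (\<lambda>k. if k = i then (0, Complex 1 t) else (0::complex \<times> complex))"
  have "knot_sum x \<theta> j = (if i < j then x j - t else 0)" for j
    unfolding s[symmetric] knot_sum_def by (intro sum.cong) (auto simp: \<theta>_def)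
  then have 1: "\<forall>j\<in>{1..n}. max 0 (x j - t) = 0 + 0 * x j + knot_sum x \<theta> j"
    using pos by simp
  have "knot_sum x \<theta>' j = (if i < j then - (x j - t) else 0)" for j
    unfolding s[symmetric] knot_sum_def by (intro sum.cong) (auto simp: \<theta>'_def)
  then have 2: "\<forall>j\<in>{1..n}. - max 0 (x j - t) = 0 + 0 * x j + knot_sum x \<theta>' j"
    using pos by simp
  have "Complex 1 t \<in> knot_cone x i" "0 \<in> knot_cone x j" for j
    using t by (auto simp: knot_cone_def)
  then have 3: "\<forall>k\<in>{1..<n}. fst (\<theta> k) \<in> knot_cone x k \<and> snd (\<theta> k) \<in> knot_cone x k"
    "\<forall>k\<in>{1..<n}. fst (\<theta>' k) \<in> knot_cone x k \<and> snd (\<theta>' k) \<in> knot_cone x k"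
    by (auto simp: \<theta>_def \<theta>'_def)
  have "knots_fit n x (\<lambda>j. max 0 (x j - t)) \<theta>" "knots_fit n x (\<lambda>j. - max 0 (x j - t)) \<theta>'"
    unfolding knots_fit_def using 1 2 3 by blast+
  then show "knots_fit n x (\<lambda>j. max 0 (x j - t)) (\<lambda>k. if k = i then (Complex 1 t, 0) else 0)"
    "knots_fit n x (\<lambda>j. - max 0 (x j - t)) (\<lambda>k. if k = i then (0, Complex 1 t) else 0)"
    unfolding \<theta>_def \<theta>'_def .
qed

lemma knot_duality:
  assumes n: "2 \<le> n" and x: "strict_mono_on {1..n} x"
  obtains k \<theta> where "(\<Sum>j\<in>{1..n}. k j) = 0" "(\<Sum>j\<in>{1..n}. k j * x j) = 0"
    "\<And>t. \<bar>\<Sum>j\<in>{1..n}. k j * max 0 (x j - t)\<bar> \<le> sqrt (1 + t\<^sup>2)"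
    "knots_fit n x y \<theta>" "knot_cost n \<theta> = (\<Sum>j\<in>{1..n}. k j * y j)"
proof -
  have loc: "knot_value n x u = knot_value n x v" if "\<And>j. j \<in> {1..n} \<Longrightarrow> u j = v j" for u v
  proof -
    have "knots_fit n x u = knots_fit n x v"
      using that by (intro ext) (simp add: knots_fit_def)
    then show ?thesis by (simp add: knot_value_def)
  qed
  obtain k where k: "\<And>v. (\<Sum>j\<in>{1..n}. k j * v j) \<le> knot_value n x v"
      "(\<Sum>j\<in>{1..n}. k j * y j) = knot_value n x y"
    using finite_Hahn_Banach[OF sublinear_knot_value[OF n x], of "{1..n}" y] loc by blast
  obtain \<theta> where \<theta>: "knots_fit n x y \<theta>" "knot_cost n \<theta> = knot_value n x y"
    using knot_value_attained[OF n x] by blast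
  \<comment> \<open>Affine data cost nothing, so \<open>k\<close> is nonpositive on them; as they
    form a linear space, it vanishes there.\<close>
  have aff: "(\<Sum>j\<in>{1..n}. k j * (A + B * x j)) \<le> 0" for A B
  proof -
    have "knots_fit n x (\<lambda>j. A + B * x j) (\<lambda>i. 0)"
      by (auto simp: knots_fit_def knot_cone_def knot_sum_def)
    then have "knot_value n x (\<lambda>j. A + B * x j) \<le> 0"
      using knot_value_le by (fastforce simp: knot_cost_def)
    then show ?thesis using k(1)[of "\<lambda>j. A + B * x j"] by linarith
  qed
  have k0: "(\<Sum>j\<in>{1..n}. k j) = 0" using aff[of 1 0] aff[of "-1" 0] by (simp add: sum_negf)
  have k1: "(\<Sum>j\<in>{1..n}. k j * x j) = 0" using aff[of 0 1] aff[of 0 "-1"] by (simp add: sum_negf)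
  have bound: "\<bar>\<Sum>j\<in>{1..n}. k j * max 0 (x j - t)\<bar> \<le> sqrt (1 + t\<^sup>2)" for t
  proof -
    have mono: "x j \<le> x l" if "j \<in> {1..n}" "l \<in> {1..n}" "j \<le> l" for j l
      using that strict_mono_on_leD[OF x] by blast
    \<comment> \<open>Knots live between \<open>x 1\<close> and \<open>x n\<close>. Beyond these
      nodes the certificate is 0, on the left by the moment conditions and on the right because
      every hinge is 0.\<close>
    consider "t < x 1" | "x n < t" | "x 1 \<le> t" "t \<le> x n" by linarith
    then show ?thesis
    proof cases
      case 1
      have "max 0 (x j - t) = x j - t" if "j \<in> {1..n}" for j
        using 1 mono[of 1 j] that n by simp
      then have "(\<Sum>j\<in>{1..n}. k j * max 0 (x j - t)) = (\<Sum>j\<in>{1..n}. k j * (x j - t))"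
        by (intro sum.cong) auto
      also have "\<dots> = (\<Sum>j\<in>{1..n}. k j * x j) - t * (\<Sum>j\<in>{1..n}. k j)"
        by (simp add: sum_distrib_left sum_subtractf[symmetric] right_diff_distrib mult.commute)
      finally have "(\<Sum>j\<in>{1..n}. k j * max 0 (x j - t)) = (\<Sum>j\<in>{1..n}. k j * x j) - t * (\<Sum>j\<in>{1..n}. k j)" .
      then show ?thesis using k0 k1 by simp
    next
      case 2
      have "max 0 (x j - t) = 0" if "j \<in> {1..n}" for j
        using 2 mono[of j n] that n by simp
      then show ?thesis by simp
    next
      case 3
      then obtain i where i: "i \<in> {1..<n}" "x i \<le> t" "t \<le> x (Suc i)"
        using node_interval[OF n] by blast
      note h = knots_fit_hinge[OF x i]
      have s: "(\<Sum>k\<in>{1..<n}. if k = i then r else 0) = r" for r :: real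
        using i by simp
      have c: "knot_cost n (\<lambda>k. if k = i then (Complex 1 t, 0) else 0) = sqrt (1 + t\<^sup>2)"
          "knot_cost n (\<lambda>k. if k = i then (0, Complex 1 t) else 0) = sqrt (1 + t\<^sup>2)"
        unfolding knot_cost_def by (subst (2) s[symmetric], intro sum.cong, auto simp: cmod_def)+
      have "(\<Sum>j\<in>{1..n}. k j * max 0 (x j - t)) \<le> sqrt (1 + t\<^sup>2)"
        using k(1)[of "\<lambda>j. max 0 (x j - t)"] knot_value_le[OF h(1)] c by linarith
      moreover have "- (\<Sum>j\<in>{1..n}. k j * max 0 (x j - t)) \<le> sqrt (1 + t\<^sup>2)"
        using k(1)[of "\<lambda>j. - max 0 (x j - t)"] knot_value_le[OF h(2)] c by (simp add: sum_negf)
      ultimately show ?thesis by linarith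
    qed
  qed
  show ?thesis using that[OF k0 k1 bound \<theta>(1)] \<theta>(2) k(2) by simp
qed

section \<open>Contact set of the dual certificate\<close>

text \<open>A line below the graph of \<open>sqrt (1 + t\<^sup>2)\<close> near a contact point is the tangent
  \<open>(1 + a t) / sqrt (1 + a\<^sup>2)\<close> there, and Cauchy--Schwarz for \<open>(1, a)\<close> and \<open>(1, t)\<close>
  keeps it strictly between both branches of the hyperbola elsewhere.\<close>

lemma affine_contact:
  fixes \<alpha> \<beta> a :: real
  assumes a: "l < a" "a < r"
    and le: "\<And>t. t \<in> {l..r} \<Longrightarrow> \<bar>\<alpha> + \<beta> * t\<bar> \<le> sqrt (1 + t\<^sup>2)"
    and eq: "\<bar>\<alpha> + \<beta> * a\<bar> = sqrt (1 + a\<^sup>2)"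
  shows "t \<noteq> a \<Longrightarrow> \<bar>\<alpha> + \<beta> * t\<bar> < sqrt (1 + t\<^sup>2)"
    and "\<alpha> + \<beta> * t = 0 \<Longrightarrow> 1 + a * t = 0"
proof -
  define w where "w t = sqrt (1 + t\<^sup>2)" for t :: real
  \<comment> \<open>The sign \<open>s\<close> folds the lower branch of the hyperbola onto the upper
    one.\<close>
  define s where "s = sgn (\<alpha> + \<beta> * a)"
  have wpos: "w t > 0" for t by (simp add: w_def add_pos_nonneg)
  have w2: "w t * w t = 1 + t\<^sup>2" for t by (simp add: w_def)
  have s: "\<bar>s\<bar> = 1" "s * (\<alpha> + \<beta> * a) = w a"
    using eq wpos[of a] by (auto simp: s_def w_def abs_sgn_eq sgn_mult_abs mult.commute abs_sgn)
  have "((\<lambda>t. w t - s * (\<alpha> + \<beta> * t)) has_real_derivative a / w a - s * \<beta>) (at a)"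
    unfolding w_def using add_pos_nonneg[OF zero_less_one zero_le_power2[of a]]
    by (auto intro!: derivative_eq_intros simp: divide_simps)
  moreover have "\<forall>t. \<bar>a - t\<bar> < min (a - l) (r - a) \<longrightarrow> w a - s * (\<alpha> + \<beta> * a) \<le> w t - s * (\<alpha> + \<beta> * t)"
  proof (intro allI impI)
    fix t assume "\<bar>a - t\<bar> < min (a - l) (r - a)"
    then have "t \<in> {l..r}" by auto
    then have "\<bar>s * (\<alpha> + \<beta> * t)\<bar> \<le> w t" using le s(1) by (simp add: abs_mult w_def)
    then show "w a - s * (\<alpha> + \<beta> * a) \<le> w t - s * (\<alpha> + \<beta> * t)" using s(2) by linarith
  qed
  ultimately have "a / w a - s * \<beta> = 0"
    using a by (intro DERIV_local_min[of _ _ a "min (a - l) (r - a)"]) auto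
  then have slope: "s * \<beta> * w a = a" using wpos[of a] by (simp add: field_simps)
  have tangent: "s * (\<alpha> + \<beta> * t) * w a = 1 + a * t" for t
  proof -
    have "s * (\<alpha> + \<beta> * t) * w a = s * (\<alpha> + \<beta> * a) * w a + (s * \<beta> * w a) * (t - a)"
      by (simp add: algebra_simps)
    also have "\<dots> = 1 + a * t" using s(2) slope w2[of a] by (simp add: algebra_simps power2_eq_square)
    finally show ?thesis .
  qed
  show "\<alpha> + \<beta> * t = 0 \<Longrightarrow> 1 + a * t = 0" using tangent[of t] by simp
  assume "t \<noteq> a"
  \<comment> \<open>The two sides differ by \<open>(a - t)\<^sup>2\<close>.\<close>
  then have "(1 + a * t)\<^sup>2 < (1 + a\<^sup>2) * (1 + t\<^sup>2)"
    using zero_less_power2[of "a - t"] by (simp add: power2_eq_square algebra_simps)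
  then have "\<bar>1 + a * t\<bar> < w a * w t"
    unfolding w_def real_sqrt_mult[symmetric] by (metis real_sqrt_abs real_sqrt_less_mono)
  moreover have "\<bar>1 + a * t\<bar> = \<bar>\<alpha> + \<beta> * t\<bar> * w a"
    unfolding tangent[symmetric] using s(1) wpos[of a] by (simp add: abs_mult)
  ultimately show "\<bar>\<alpha> + \<beta> * t\<bar> < sqrt (1 + t\<^sup>2)"
    using wpos[of a] by (simp add: mult.commute w_def[symmetric])
qed

section \<open>Agreement spreading from one interval to the whole line\<close>

text \<open>What remains of a second derivative carried by \<open>S\<close> once the measures are
  gone. The affine formula holds on the closed interval, so zeros at its end points count.\<close>

definition affine_off :: "(real \<Rightarrow> real) \<Rightarrow> real set \<Rightarrow> bool" where
  "affine_off d S \<longleftrightarrow>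
     (\<forall>u v. u < v \<longrightarrow> {u<..<v} \<inter> S = {} \<longrightarrow> (\<exists>\<alpha> \<beta>. \<forall>t\<in>{u..v}. d t = \<alpha> + \<beta> * t))"

lemma affine_off_zero:
  assumes "affine_off d S" "{u<..<v} \<inter> S = {}"
    and pq: "p \<in> {u..v}" "q \<in> {u..v}" "p \<noteq> q" "d p = 0" "d q = 0" and t: "t \<in> {u..v}"
  shows "d t = 0"
proof -
  have "u < v" using pq by auto
  then obtain \<alpha> \<beta> where d: "\<And>t. t \<in> {u..v} \<Longrightarrow> d t = \<alpha> + \<beta> * t"
    using assms(1,2) unfolding affine_off_def by blast
  have "\<beta> * (p - q) = (\<alpha> + \<beta> * p) - (\<alpha> + \<beta> * q)" by (simp add: algebra_simps)
  also have "\<dots> = 0" using d[OF pq(1)] d[OF pq(2)] pq(4,5) by simp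
  finally have "\<beta> * (p - q) = 0" .
  then have "\<beta> = 0" using pq(3) by simp
  then show ?thesis using d[OF pq(1)] d[OF t] pq(4) by simp
qed

text \<open>The second alternative speaks of the closed interval: a contact inside excludes contacts
  at both end nodes, so an affine piece can be continued across them. In the first alternative a
  node may be a contact.\<close>

definition isolated_contacts :: "nat \<Rightarrow> (nat \<Rightarrow> real) \<Rightarrow> real set \<Rightarrow> bool" where
  "isolated_contacts n x S \<longleftrightarrow>
     (\<forall>i\<in>{1..<n}. {x i<..<x (Suc i)} \<inter> S = {} \<or>
        (\<exists>a. x i < a \<and> a < x (Suc i) \<and> {x i..x (Suc i)} \<inter> S = {a}))"

text \<open>On interval \<open>k\<close> the zeros at the two nodes kill \<open>d\<close>. On
  entering an interval with a contact \<open>a\<close>, the node \<open>x m\<close> is no contact,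
  so \<open>d\<close> is affine up to \<open>a\<close> from some \<open>u < x m\<close> where it is
  already 0. The zeros at \<open>u\<close> and \<open>x m\<close> give \<open>d = 0\<close> as far
  as \<open>a\<close>, and those at \<open>a\<close> and \<open>x (Suc m)\<close> do the rest. The
  last piece continues across \<open>x n\<close> in the same way.\<close>

lemma affine_off_zero_right:
  assumes x: "strict_mono_on {1..n} x" and d: "affine_off d S"
    and nodes: "\<And>j. j \<in> {1..n} \<Longrightarrow> d (x j) = 0"
    and S: "isolated_contacts n x S" "{x n..} \<inter> S = {}"
    and k: "k \<in> {1..<n}" "{x k<..<x (Suc k)} \<inter> S = {}"
    and t: "x k \<le> t"
  shows "d t = 0"
proof -
  have less: "x i < x j" if "1 \<le> i" "i < j" "j \<le> n" for i j
    using that by (intro strict_mono_onD[OF x]) auto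
  \<comment> \<open>\<open>u\<close> is the left node or the contact inside, the point where the
    last contact-free stretch before \<open>x (Suc i)\<close> begins.\<close>
  have gap: "\<exists>u. x i \<le> u \<and> u < x (Suc i) \<and> {u<..<x (Suc i)} \<inter> S = {}" if i: "i \<in> {1..<n}" for i
  proof (cases "{x i<..<x (Suc i)} \<inter> S = {}")
    case True
    then show ?thesis using less[of i "Suc i"] i by (intro exI[of _ "x i"]) auto
  next
    case False
    then obtain a where a: "x i < a" "a < x (Suc i)" "{x i..x (Suc i)} \<inter> S = {a}"
      using S(1) i unfolding isolated_contacts_def by blast
    have "s \<notin> S" if "a < s" "s < x (Suc i)" for s
    proof -
      have "s \<in> {x i..x (Suc i)}" "s \<noteq> a" using that a by auto
      then show ?thesis using a(3) by blast
    qed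
    then show ?thesis using a by (intro exI[of _ a]) auto
  qed
  have "\<forall>t\<in>{x k..x m}. d t = 0" if "Suc k \<le> m" "m \<le> n" for m
    using that
  proof (induction m rule: dec_induct)
    case base
    have "x k < x (Suc k)" "d (x k) = 0" "d (x (Suc k)) = 0" using less nodes k(1) by auto
    then show ?case using affine_off_zero[OF d k(2), of "x k" "x (Suc k)"] by auto
  next
    case (step m)
    then have IH: "\<And>t. t \<in> {x k..x m} \<Longrightarrow> d t = 0" and m: "m \<in> {1..<n}" "m - 1 \<in> {1..<n}" "k \<le> m - 1" "Suc (m - 1) = m"
      using k by auto
    have lt: "x m < x (Suc m)" using less m by auto
    have n0: "d (x m) = 0" "d (x (Suc m)) = 0" using nodes m by auto
    have "d t = 0" if t: "t \<in> {x m..x (Suc m)}" for t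
    proof (cases "{x m<..<x (Suc m)} \<inter> S = {}")
      case True
      show ?thesis using affine_off_zero[OF d True, of "x m" "x (Suc m)"] n0 lt t by auto
    next
      case False
      then obtain a where a: "x m < a" "a < x (Suc m)" "{x m..x (Suc m)} \<inter> S = {a}"
        using S(1) m unfolding isolated_contacts_def by blast
      obtain u where u: "x (m - 1) \<le> u" "u < x m" "{u<..<x m} \<inter> S = {}" using gap[OF m(2)] m(4) by auto
      have "x k \<le> x (m - 1)" using less[of k "m - 1"] k m by (cases "k = m - 1") auto
      then have du: "d u = 0" using IH u by auto
      have c1: "{u<..<a} \<inter> S = {}"
      proof -
        have "s \<notin> S" if "u < s" "s < a" for s
        proof (cases "s < x m")
          case True then show ?thesis using u(3) that by auto
        next
          case False
          then have "s \<in> {x m..x (Suc m)}" "s \<noteq> a" using that a by auto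
          then show ?thesis using a(3) by blast
        qed
        then show ?thesis by auto
      qed
      have left: "d s = 0" if "s \<in> {u..a}" for s
        using affine_off_zero[OF d c1, of u "x m" s] du n0 u a that by auto
      have c2: "{a<..<x (Suc m)} \<inter> S = {}"
      proof -
        have "s \<notin> S" if "a < s" "s < x (Suc m)" for s
        proof -
          have "s \<in> {x m..x (Suc m)}" "s \<noteq> a" using that a by auto
          then show ?thesis using a(3) by blast
        qed
        then show ?thesis by auto
      qed
      have "d a = 0" using left u a by auto
      then have "d s = 0" if "s \<in> {a..x (Suc m)}" for s
        using affine_off_zero[OF d c2, of a "x (Suc m)" s] n0 a that by auto
      then show ?thesis using left t u by (cases "t \<le> a") auto
    qed
    then show ?case using IH by (meson atLeastAtMost_iff linear)
  qed
  from this[of n] have inner: "\<And>t. t \<in> {x k..x n} \<Longrightarrow> d t = 0" using k by auto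
  show ?thesis
  proof (cases "t \<le> x n")
    case True then show ?thesis using inner t by auto
  next
    case False
    have n: "n - 1 \<in> {1..<n}" "Suc (n - 1) = n" using k by auto
    obtain u where u: "x (n - 1) \<le> u" "u < x n" "{u<..<x n} \<inter> S = {}" using gap[OF n(1)] n(2) by auto
    have "k < n - 1 \<or> k = n - 1" using k by auto
    then have "x k \<le> x (n - 1)" using less[of k "n - 1"] k by auto
    then have "d u = 0" using inner u by auto
    moreover have "{u<..<t} \<inter> S = {}"
    proof -
      have "s \<notin> S" if "u < s" for s
        using u(3) S(2) that by (cases "s < x n") (auto simp: disjoint_iff)
      then show ?thesis by auto
    qed
    ultimately show ?thesis
      using affine_off_zero[OF d, of u t u "x n" t] nodes[of n] u False n by auto
  qed
qed

text \<open>Reflection of \<open>affine_off_zero_right\<close> at the origin. Node \<open>j\<close>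
  becomes node \<open>Suc n - j\<close>, so interval \<open>i\<close> becomes interval
  \<open>n - i\<close>.\<close>

lemma affine_off_zero_left:
  assumes x: "strict_mono_on {1..n} x" and d: "affine_off d S"
    and nodes: "\<And>j. j \<in> {1..n} \<Longrightarrow> d (x j) = 0"
    and S: "isolated_contacts n x S" "{..x 1} \<inter> S = {}"
    and k: "k \<in> {1..<n}" "{x k<..<x (Suc k)} \<inter> S = {}"
    and t: "t \<le> x (Suc k)"
  shows "d t = 0"
proof -
  define x' where "x' j = - x (Suc n - j)" for j
  define d' where "d' t = d (- t)" for t
  define S' where "S' = {t. - t \<in> S}"
  have "d' (- t) = 0"
  proof (rule affine_off_zero_right[where n = n and x = x' and S = S' and k = "n - k" and d = d' and t = "- t"])
    show "strict_mono_on {1..n} x'"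
      unfolding x'_def by (intro strict_mono_onI) (auto intro!: strict_mono_onD[OF x])
    show "affine_off d' S'"
      unfolding affine_off_def
    proof (intro allI impI)
      fix u v :: real assume uv: "u < v" "{u<..<v} \<inter> S' = {}"
      have "s \<notin> S" if "- v < s" "s < - u" for s
        using uv(2) that by (auto simp: S'_def disjoint_iff dest: spec[of _ "- s"])
      with uv(1) have "- v < - u" "{-v<..<-u} \<inter> S = {}" by auto
      then obtain \<alpha> \<beta> where "\<And>t. t \<in> {-v..-u} \<Longrightarrow> d t = \<alpha> + \<beta> * t"
        using d unfolding affine_off_def by metis
      then have "\<forall>t\<in>{u..v}. d' t = \<alpha> + (- \<beta>) * t" by (auto simp: d'_def)
      then show "\<exists>\<alpha> \<beta>. \<forall>t\<in>{u..v}. d' t = \<alpha> + \<beta> * t" by blast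
    qed
    show "d' (x' j) = 0" if "j \<in> {1..n}" for j
    proof -
      have "Suc n - j \<in> {1..n}" using that by auto
      then show ?thesis using nodes by (simp add: d'_def x'_def)
    qed
    have flip: "{x' i<..<x' (Suc i)} \<inter> S' = uminus ` ({x (n - i)<..<x (Suc (n - i))} \<inter> S)"
      "{x' i..x' (Suc i)} \<inter> S' = uminus ` ({x (n - i)..x (Suc (n - i))} \<inter> S)" if "i \<in> {1..<n}" for i
    proof -
      have "Suc n - i = Suc (n - i)" "Suc n - Suc i = n - i" using that by auto
      then show "{x' i<..<x' (Suc i)} \<inter> S' = uminus ` ({x (n - i)<..<x (Suc (n - i))} \<inter> S)"
        "{x' i..x' (Suc i)} \<inter> S' = uminus ` ({x (n - i)..x (Suc (n - i))} \<inter> S)"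
        by (auto simp: x'_def S'_def image_iff intro!: bexI[of _ "- _"])
    qed
    show "isolated_contacts n x' S'"
      unfolding isolated_contacts_def
    proof
      fix i assume i: "i \<in> {1..<n}"
      then have ni: "n - i \<in> {1..<n}" "Suc n - i = Suc (n - i)" by auto
      from S(1) ni(1) consider "{x (n - i)<..<x (Suc (n - i))} \<inter> S = {}"
        | a where "x (n - i) < a" "a < x (Suc (n - i))" "{x (n - i)..x (Suc (n - i))} \<inter> S = {a}"
        unfolding isolated_contacts_def by blast
      then show "{x' i<..<x' (Suc i)} \<inter> S' = {} \<or>
         (\<exists>a. x' i < a \<and> a < x' (Suc i) \<and> {x' i..x' (Suc i)} \<inter> S' = {a})"
      proof cases
        case 1 then show ?thesis using flip[OF i] by simp
      next
        case (2 a)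
        then have "x' i < - a \<and> - a < x' (Suc i) \<and> {x' i..x' (Suc i)} \<inter> S' = {- a}"
          unfolding flip(2)[OF i] using ni by (simp add: x'_def)
        then show ?thesis by blast
      qed
    qed
    show "{x' n..} \<inter> S' = {}" using S(2) by (auto simp: x'_def S'_def disjoint_iff minus_le_iff)
    show nk: "n - k \<in> {1..<n}" using k by auto
    show "{x' (n - k)<..<x' (Suc (n - k))} \<inter> S' = {}" using flip(1)[OF nk] k by simp
    show "x' (n - k) \<le> - t" using t k by (simp add: x'_def Suc_diff_le)
  qed
  then show ?thesis by (simp add: d'_def)
qed

lemma hinge_sum_contacts:
  fixes x k :: "nat \<Rightarrow> real"
  assumes n: "2 \<le> n" and x: "strict_mono_on {1..n} x"
    and k: "(\<Sum>j\<in>{1..n}. k j) = 0" "(\<Sum>j\<in>{1..n}. k j * x j) = 0"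
  defines "\<eta> \<equiv> \<lambda>t. \<Sum>j\<in>{1..n}. k j * max 0 (x j - t)"
  assumes le: "\<And>t. \<bar>\<eta> t\<bar> \<le> sqrt (1 + t\<^sup>2)"
  defines "S \<equiv> {t. \<bar>\<eta> t\<bar> = sqrt (1 + t\<^sup>2)}"
  shows "isolated_contacts n x S" "{x n..} \<inter> S = {}" "{..x 1} \<inter> S = {}"
    and "\<exists>i\<in>{1..<n}. {x i<..<x (Suc i)} \<inter> S = {}"
proof -
  have less: "x i < x j" if "1 \<le> i" "i < j" "j \<le> n" for i j
    using that by (intro strict_mono_onD[OF x]) auto
  have leq: "x i \<le> x j" if "1 \<le> i" "i \<le> j" "j \<le> n" for i j
    using less[of i j] that by (cases "i = j") auto
  have right: "\<eta> t = 0" if "x n \<le> t" for t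
    unfolding \<eta>_def using leq[of _ n] that by (intro sum.neutral) fastforce
  have left: "\<eta> t = 0" if "t \<le> x 1" for t
  proof -
    have "\<eta> t = (\<Sum>j\<in>{1..n}. k j * x j - t * k j)"
      unfolding \<eta>_def using leq[of 1] that by (intro sum.cong) (fastforce simp: algebra_simps)+
    also have "\<dots> = (\<Sum>j\<in>{1..n}. k j * x j) - t * (\<Sum>j\<in>{1..n}. k j)"
      by (simp add: sum_subtractf sum_distrib_left)
    finally show ?thesis using k by simp
  qed
  have pos: "0 < sqrt (1 + t\<^sup>2)" for t :: real by (simp add: add_pos_nonneg)
  have notS: "t \<notin> S" if "\<eta> t = 0" for t using that pos[of t] by (simp add: S_def)
  show "{x n..} \<inter> S = {}" "{..x 1} \<inter> S = {}" using right left notS by auto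
  have piece: "\<exists>\<alpha> \<beta>. \<forall>t\<in>{x i..x (Suc i)}. \<eta> t = \<alpha> + \<beta> * t" if i: "i \<in> {1..<n}" for i
  proof -
    have "\<eta> t = (\<Sum>j\<in>{1..n}. if i < j then k j * x j else 0) + (\<Sum>j\<in>{1..n}. if i < j then - k j else 0) * t"
      if t: "t \<in> {x i..x (Suc i)}" for t
    proof -
      have "k j * max 0 (x j - t) = (if i < j then k j * x j else 0) + (if i < j then - k j else 0) * t"
        if "j \<in> {1..n}" for j
        using that t i leq[of "Suc i" j] leq[of j i] by (auto simp: max_def algebra_simps)
      then show ?thesis unfolding \<eta>_def sum_distrib_right sum.distrib[symmetric] by (intro sum.cong) auto
    qed
    then show ?thesis by blast
  qed
  have contact: "{x i..x (Suc i)} \<inter> S = {a}" "\<And>t. t \<in> {x i..x (Suc i)} \<Longrightarrow> \<eta> t = 0 \<Longrightarrow> 1 + a * t = 0"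
    if i: "i \<in> {1..<n}" and a: "x i < a" "a < x (Suc i)" "a \<in> S" for i a
  proof -
    obtain \<alpha> \<beta> where \<eta>: "\<And>t. t \<in> {x i..x (Suc i)} \<Longrightarrow> \<eta> t = \<alpha> + \<beta> * t" using piece[OF i] by blast
    have 1: "\<bar>\<alpha> + \<beta> * t\<bar> \<le> sqrt (1 + t\<^sup>2)" if "t \<in> {x i..x (Suc i)}" for t
      using le[of t] \<eta>[OF that] by simp
    have 2: "\<bar>\<alpha> + \<beta> * a\<bar> = sqrt (1 + a\<^sup>2)" using a \<eta>[of a] by (simp add: S_def)
    note c = affine_contact[OF a(1,2) 1 2]
    show "1 + a * t = 0" if "t \<in> {x i..x (Suc i)}" "\<eta> t = 0" for t
      using c(2)[of t] that \<eta>[of t] by simp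
    have "t = a" if "t \<in> {x i..x (Suc i)}" "t \<in> S" for t
      using c(1)[of t] that \<eta>[of t] by (auto simp: S_def)
    then show "{x i..x (Suc i)} \<inter> S = {a}" using a by auto
  qed
  show "isolated_contacts n x S"
    unfolding isolated_contacts_def
  proof
    fix i assume i: "i \<in> {1..<n}"
    show "{x i<..<x (Suc i)} \<inter> S = {} \<or> (\<exists>a. x i < a \<and> a < x (Suc i) \<and> {x i..x (Suc i)} \<inter> S = {a})"
    proof (cases "{x i<..<x (Suc i)} \<inter> S = {}")
      case False
      then obtain a where "x i < a" "a < x (Suc i)" "a \<in> S" by auto
      then show ?thesis using contact(1)[OF i] by blast
    qed simp
  qed
  show "\<exists>i\<in>{1..<n}. {x i<..<x (Suc i)} \<inter> S = {}"
  proof (rule ccontr)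
    assume "\<not> ?thesis"
    then have ex: "\<exists>a. x i < a \<and> a < x (Suc i) \<and> a \<in> S" if "i \<in> {1..<n}" for i
      using that by (auto simp: disjoint_iff)
    \<comment> \<open>Tangency at \<open>a\<close> and the zero of the certificate at
      \<open>x 1\<close> give \<open>1 + a * x 1 = 0\<close>, so \<open>a\<close> and
      \<open>x 1\<close> have opposite signs, and \<open>a\<close>, the larger one, is positive. A
      contact \<open>b\<close> in the last interval is then positive too, whereas
      \<open>1 + b * x n = 0\<close> with \<open>b < x n\<close> asks two positive numbers for a
      negative product.\<close>
    have first: "0 < a" if "x 1 < a" "a < x 2" "a \<in> S" for a
    proof -
      have "1 + a * x 1 = 0"
        using contact(2)[of 1 a "x 1"] that n left less[of 1 2] by (simp add: numeral_2_eq_2)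
      then have "a * x 1 < 0" by linarith
      then show ?thesis using that by (auto simp: mult_less_0_iff)
    qed
    obtain a where a: "x 1 < a" "a < x 2" "a \<in> S" using ex[of 1] n by (auto simp: numeral_2_eq_2)
    have n1: "n - 1 \<in> {1..<n}" "Suc (n - 1) = n" using n by auto
    obtain b where b: "x (n - 1) < b" "b < x n" "b \<in> S" using ex[OF n1(1)] n1(2) by auto
    have "0 < b"
    proof (cases "n = 2")
      case True then show ?thesis using first b by simp
    next
      case False
      then have "x 2 \<le> x (n - 1)" using n by (intro leq) auto
      then show ?thesis using first[OF a] a b by linarith
    qed
    moreover have "1 + b * x n = 0"
      using contact(2)[OF n1(1) _ _ b(3), of "x n"] b right[of "x n"] n1(2) by simp
    ultimately show False using b mult_pos_pos[of b "x n"] by linarith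
  qed
qed

section \<open>Existence and uniqueness of the minimiser\<close>

text \<open>Pairing with a tent over \<open>u\<close>, \<open>t\<close>, \<open>v\<close>, which
  vanishes on \<open>S\<close>, shows that the three points of the graph are collinear.\<close>

lemma affine_off_second_deriv:
  assumes f: "has_second_deriv_measure f P N" "L-lipschitz_on UNIV f"
    and S: "AE t in P. t \<in> S" "AE t in N. t \<in> S"
  shows "affine_off f S"
  unfolding affine_off_def
proof (intro allI impI)
  fix u v :: real assume uv: "u < v" "{u<..<v} \<inter> S = {}"
  have line: "(v - t) * f u - (v - u) * f t + (t - u) * f v = 0" if t: "t \<in> {u..v}" for t
  proof -
    define J where "J = {..<3::nat}"
    \<comment> \<open>The weights of the second divided difference at \<open>u\<close>,
      \<open>t\<close>, \<open>v\<close>, cleared of denominators, so that \<open>t = u\<close> and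
      \<open>t = v\<close> are covered as well.\<close>
    define z k where "z = (\<lambda>j. [u, t, v] ! j)" and "k = (\<lambda>j. [v - t, u - v, t - u] ! j)"
    have s: "sum g J = g 0 + g 1 + g 2" for g :: "nat \<Rightarrow> real"
      by (simp add: J_def eval_nat_numeral)
    define \<eta> where "\<eta> = (\<lambda>s. \<Sum>j\<in>J. k j * max 0 (z j - s))"
    have k: "finite J" "(\<Sum>j\<in>J. k j) = 0" "(\<Sum>j\<in>J. k j * z j) = 0"
      unfolding s by (simp_all add: J_def k_def z_def algebra_simps)
    have z: "z j \<in> {u..v}" if "j \<in> J" for j
    proof -
      have "j = 0 \<or> j = 1 \<or> j = 2" using that by (auto simp: J_def)
      then show ?thesis using t by (auto simp: z_def)
    qed
    have "\<eta> s = 0" if "s \<in> S" for s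
      unfolding \<eta>_def using that uv by (intro hinge_sum_compact_support[OF k(2,3) z]) auto
    then have "(LINT s|P. \<eta> s) = 0" "(LINT s|N. \<eta> s) = 0"
      using S by (auto intro!: integral_eq_zero_AE elim: eventually_mono)
    then have "(\<Sum>j\<in>J. k j * f (z j)) = 0"
      using second_deriv_pairing(3)[OF f k] by (simp add: \<eta>_def)
    then show ?thesis unfolding s by (simp add: z_def k_def left_diff_distrib)
  qed
  have "f t = (v * f u - u * f v) / (v - u) + (f v - f u) / (v - u) * t" if "t \<in> {u..v}" for t
  proof -
    have "f t * (v - u) = (v * f u - u * f v) + (f v - f u) * t"
      using line[OF that] by (simp add: algebra_simps)
    then have "f t = ((v * f u - u * f v) + (f v - f u) * t) / (v - u)"
      using uv(1) by (simp add: eq_divide_eq)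
    then show ?thesis by (simp add: add_divide_distrib)
  qed
  then show "\<exists>\<alpha> \<beta>. \<forall>t\<in>{u..v}. f t = \<alpha> + \<beta> * t" by blast
qed

lemma affine_off_diff:
  assumes "affine_off f S" "affine_off g S"
  shows "affine_off (\<lambda>t. f t - g t) S"
  unfolding affine_off_def
proof (intro allI impI)
  fix u v :: real assume uv: "u < v" "{u<..<v} \<inter> S = {}"
  obtain \<alpha> \<beta> where f: "\<And>t. t \<in> {u..v} \<Longrightarrow> f t = \<alpha> + \<beta> * t" using assms(1) uv unfolding affine_off_def by metis
  obtain \<gamma> \<delta> where g: "\<And>t. t \<in> {u..v} \<Longrightarrow> g t = \<gamma> + \<delta> * t" using assms(2) uv unfolding affine_off_def by metis
  have "\<forall>t\<in>{u..v}. f t - g t = (\<alpha> - \<gamma>) + (\<beta> - \<delta>) * t" using f g by (simp add: algebra_simps)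
  then show "\<exists>\<alpha> \<beta>. \<forall>t\<in>{u..v}. f t - g t = \<alpha> + \<beta> * t" by blast
qed

text \<open>Weak duality and complementary slackness. The gap between cost and pairing is the
  integral of \<open>w t - \<eta> t\<close> against \<open>P\<close> plus that of
  \<open>w t + \<eta> t\<close> against \<open>N\<close>, both with nonnegative integrands; if it is
  0, both measures live on the contact set. The equality case asks for a nonnegative value because
  \<open>ennreal\<close> sends negative reals to 0.\<close>

lemma dual_certificate:
  fixes z :: "'i \<Rightarrow> real"
  assumes J: "finite J" "(\<Sum>j\<in>J. k j) = 0" "(\<Sum>j\<in>J. k j * z j) = 0"
  defines "\<eta> \<equiv> \<lambda>t. \<Sum>j\<in>J. k j * max 0 (z j - t)"
  assumes le: "\<And>t. \<bar>\<eta> t\<bar> \<le> sqrt (1 + t\<^sup>2)"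
  shows "ennreal (\<Sum>j\<in>J. k j * f (z j)) \<le> weighted_TV f"
    and "0 \<le> (\<Sum>j\<in>J. k j * f (z j)) \<Longrightarrow> weighted_TV f = ennreal (\<Sum>j\<in>J. k j * f (z j)) \<Longrightarrow>
      affine_off f {t. \<bar>\<eta> t\<bar> = sqrt (1 + t\<^sup>2)}"
proof -
  define w where "w t = sqrt (1 + t\<^sup>2)" for t :: real
  define v where "v = (\<Sum>j\<in>J. k j * f (z j))"
  have "ennreal v \<le> weighted_TV f \<and>
    (0 \<le> v \<longrightarrow> weighted_TV f = ennreal v \<longrightarrow> affine_off f {t. \<bar>\<eta> t\<bar> = w t})"
  proof (cases "weighted_TV f = \<infinity>")
    case False
    then obtain L P N where f: "L-lipschitz_on UNIV f" "has_second_deriv_measure f P N"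
      unfolding weighted_TV_def by (auto split: if_splits)
    have s: "sets P = sets borel" "sets N = sets borel"
      using f(2) unfolding has_second_deriv_measure_def signed_radon_measure_def by auto
    have wTV: "weighted_TV f = (\<integral>\<^sup>+ x. ennreal (w x) \<partial>P) + (\<integral>\<^sup>+ x. ennreal (w x) \<partial>N)"
      unfolding w_def by (rule weighted_TV_eq[OF f])
    have w0: "0 \<le> w t" for t by (simp add: w_def)
    have wm: "w \<in> borel_measurable M" if "sets M = sets borel" for M
    proof -
      have "w \<in> borel_measurable borel" unfolding w_def by measurable
      then show ?thesis using measurable_cong_sets[OF that refl] by blast
    qed
    have iw: "integrable P w" "integrable N w"
      using False wTV w0 wm s
      by (auto intro!: integrableI_nonneg simp: less_top[symmetric] ennreal_add_eq_top)
    note p = second_deriv_pairing[OF f(2,1) J, folded \<eta>_def v_def]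
    have cost: "weighted_TV f = ennreal ((LINT t|P. w t) + (LINT t|N. w t))"
      unfolding wTV using iw w0 by (simp add: nn_integral_eq_integral)
    have pos: "0 \<le> (LINT t|P. w t) + (LINT t|N. w t)"
      using w0 by (intro add_nonneg_nonneg integral_nonneg_AE) auto
    have gap: "(LINT t|P. w t) + (LINT t|N. w t) - v = (LINT t|P. w t - \<eta> t) + (LINT t|N. w t + \<eta> t)"
      using p iw by simp
    have nn: "0 \<le> w t - \<eta> t" "0 \<le> w t + \<eta> t" for t
      using le[of t] by (auto simp: w_def[symmetric] abs_le_iff)
    have nnI: "0 \<le> (LINT t|P. w t - \<eta> t)" "0 \<le> (LINT t|N. w t + \<eta> t)"
      using nn by (auto intro!: integral_nonneg_AE)
    have "affine_off f {t. \<bar>\<eta> t\<bar> = w t}" if v: "0 \<le> v" "weighted_TV f = ennreal v"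
    proof (rule affine_off_second_deriv[OF f(2,1)])
      have "(LINT t|P. w t) + (LINT t|N. w t) = v" using v cost pos by simp
      then have "(LINT t|P. w t - \<eta> t) = 0" "(LINT t|N. w t + \<eta> t) = 0" using gap nnI by linarith+
      then have "AE t in P. w t - \<eta> t = 0" "AE t in N. w t + \<eta> t = 0"
        using integral_nonneg_eq_0_iff_AE[of P "\<lambda>t. w t - \<eta> t"] integral_nonneg_eq_0_iff_AE[of N "\<lambda>t. w t + \<eta> t"]
          iw p nn by auto
      then show "AE t in P. t \<in> {t. \<bar>\<eta> t\<bar> = w t}" "AE t in N. t \<in> {t. \<bar>\<eta> t\<bar> = w t}"
        by (auto elim!: eventually_mono simp: w0 abs_of_nonneg eq_neg_iff_add_eq_0[symmetric] abs_minus_commute)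
          (metis abs_minus_cancel abs_of_nonneg add_eq_0_iff w0)+
    qed
    moreover have "ennreal v \<le> weighted_TV f" unfolding cost using gap nnI by (intro ennreal_leI) linarith
    ultimately show ?thesis by blast
  qed simp
  then show "ennreal (\<Sum>j\<in>J. k j * f (z j)) \<le> weighted_TV f"
    "0 \<le> (\<Sum>j\<in>J. k j * f (z j)) \<Longrightarrow> weighted_TV f = ennreal (\<Sum>j\<in>J. k j * f (z j)) \<Longrightarrow>
      affine_off f {t. \<bar>\<eta> t\<bar> = sqrt (1 + t\<^sup>2)}"
    unfolding v_def w_def by auto
qed

text \<open>Translates a cone element back into mass \<open>Re z\<close> at position
  \<open>Im z / Re z\<close>. If the mass is 0, the cone forces the moment to be 0 too, so no cost
  is hidden there.\<close>

lemma knot_cone_hinge: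
  assumes x: "strict_mono_on {1..n} x" and i: "i \<in> {1..<n}" and j: "j \<in> {1..n}" and z: "z \<in> knot_cone x i"
  shows "Re z * max 0 (x j - Im z / Re z) = (if i < j then Re z * x j - Im z else 0)"
    and "Re z * sqrt (1 + (Im z / Re z)\<^sup>2) = cmod z"
proof -
  have mono: "x j \<le> x k" if "j \<in> {1..n}" "k \<in> {1..n}" "j \<le> k" for j k
    using that strict_mono_on_leD[OF x] by blast
  have "Re z * max 0 (x j - Im z / Re z) = (if i < j then Re z * x j - Im z else 0) \<and>
    Re z * sqrt (1 + (Im z / Re z)\<^sup>2) = cmod z"
  proof (cases "Re z = 0")
    case True
    then have "Im z = 0" using z by (simp add: knot_cone_def)
    with True have "z = 0" by (simp add: complex_eq_iff)
    then show ?thesis by simp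
  next
    case False
    then have pos: "0 < Re z" using z by (simp add: knot_cone_def)
    then have a: "x i \<le> Im z / Re z" "Im z / Re z \<le> x (Suc i)" using z by (auto simp: knot_cone_def field_simps)
    have "cmod z = sqrt ((Re z)\<^sup>2 * (1 + (Im z / Re z)\<^sup>2))"
      using pos by (simp add: cmod_def field_simps)
    also have "\<dots> = Re z * sqrt (1 + (Im z / Re z)\<^sup>2)" using pos by (simp add: real_sqrt_mult)
    finally have "Re z * sqrt (1 + (Im z / Re z)\<^sup>2) = cmod z" by simp
    moreover have "Re z * max 0 (x j - Im z / Re z) = (if i < j then Re z * x j - Im z else 0)"
    proof (cases "i < j")
      case True
      then have "x (Suc i) \<le> x j" using i j by (intro mono) auto
      then show ?thesis using True a pos by (simp add: right_diff_distrib)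
    next
      case False
      then have "x j \<le> x i" using i j by (intro mono) auto
      then show ?thesis using False a by simp
    qed
    ultimately show ?thesis by blast
  qed
  then show "Re z * max 0 (x j - Im z / Re z) = (if i < j then Re z * x j - Im z else 0)"
    "Re z * sqrt (1 + (Im z / Re z)\<^sup>2) = cmod z" by auto
qed

text \<open>The cost is only bounded above, since atoms of opposite sign may land on one point and
  cancel. For an optimal \<theta> the certificate turns the bound into an equality.\<close>

lemma knots_fit_spline:
  assumes x: "strict_mono_on {1..n} x" and \<theta>: "knots_fit n x y \<theta>"
  obtains f where "\<And>j. j \<in> {1..n} \<Longrightarrow> f (x j) = y j" "weighted_TV f \<le> ennreal (knot_cost n \<theta>)"
proof -
  define I where "I = {1..<n}"
  have \<theta>I: "fst (\<theta> i) \<in> knot_cone x i" "snd (\<theta> i) \<in> knot_cone x i" if "i \<in> I" for i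
    using \<theta> that unfolding knots_fit_def I_def by auto
  obtain A B where AB: "\<And>j. j \<in> {1..n} \<Longrightarrow> y j = A + B * x j + knot_sum x \<theta> j"
    using \<theta> unfolding knots_fit_def by blast
  \<comment> \<open>An atom of mass 0 is placed at \<open>0 / 0 = 0\<close>, which is harmless.\<close>
  define p q where "p i = Re (fst (\<theta> i))" and "q i = Re (snd (\<theta> i))" for i
  define a b where "a i = Im (fst (\<theta> i)) / p i" and "b i = Im (snd (\<theta> i)) / q i" for i
  have pq: "0 \<le> p i" "0 \<le> q i" if "i \<in> I" for i
    using \<theta>I[OF that] by (auto simp: p_def q_def knot_cone_def)
  define T where "T = a ` I \<union> b ` I"
  have T: "finite T" by (simp add: T_def I_def)
  \<comment> \<open>Several atoms may share a point, for instance a common node, so the coefficient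
    at \<open>s\<close> collects all of them.\<close>
  define c where "c s = (\<Sum>i\<in>I. (if s = a i then p i else 0) - (if s = b i then q i else 0))" for s
  have collect: "(\<Sum>s\<in>T. \<Sum>i\<in>I. (if s = e i then r i else 0) * g s) = (\<Sum>i\<in>I. r i * g (e i))"
    if "e ` I \<subseteq> T" for e r and g :: "real \<Rightarrow> real"
  proof -
    have "(\<Sum>s\<in>T. (if s = e i then r i else 0) * g s) = r i * g (e i)" if "i \<in> I" for i
    proof -
      have "(\<Sum>s\<in>T. (if s = e i then r i else 0) * g s) = (\<Sum>s\<in>T. if s = e i then r i * g (e i) else 0)"
        by (intro sum.cong) auto
      also have "\<dots> = r i * g (e i)" using T \<open>e ` I \<subseteq> T\<close> that by auto
      finally show ?thesis .
    qed
    then show ?thesis by (subst sum.swap) simp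
  qed
  define f where "f = linear_spline A B T c"
  have "f (x j) = y j" if j: "j \<in> {1..n}" for j
  proof -
    have "(\<Sum>s\<in>T. c s * max 0 (x j - s)) = (\<Sum>i\<in>I. p i * max 0 (x j - a i)) - (\<Sum>i\<in>I. q i * max 0 (x j - b i))"
      using collect[of a p "\<lambda>s. max 0 (x j - s)"] collect[of b q "\<lambda>s. max 0 (x j - s)"]
      by (simp add: c_def T_def sum_subtractf sum_distrib_right left_diff_distrib)
    also have "\<dots> = (\<Sum>i\<in>I. if i < j then Re (fst (\<theta> i) - snd (\<theta> i)) * x j - Im (fst (\<theta> i) - snd (\<theta> i)) else 0)"
      unfolding sum_subtractf[symmetric]
    proof (intro sum.cong refl)
      fix i assume i: "i \<in> I"
      show "p i * max 0 (x j - a i) - q i * max 0 (x j - b i)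
          = (if i < j then Re (fst (\<theta> i) - snd (\<theta> i)) * x j - Im (fst (\<theta> i) - snd (\<theta> i)) else 0)"
        using knot_cone_hinge(1)[OF x _ j \<theta>I(1)[OF i]] knot_cone_hinge(1)[OF x _ j \<theta>I(2)[OF i]] i
        by (simp add: p_def q_def a_def b_def I_def left_diff_distrib)
    qed
    also have "\<dots> = knot_sum x \<theta> j"
    proof -
      have "{1..<j} = {i \<in> I. i < j}" using j by (auto simp: I_def)
      then show ?thesis
        unfolding knot_sum_def by (simp only:, intro sum.inter_filter[symmetric]) (simp add: I_def)
    qed
    finally show ?thesis using AB[OF j] by (simp add: f_def linear_spline_def)
  qed
  moreover have "weighted_TV f \<le> ennreal (knot_cost n \<theta>)"
  proof -
    define w where "w t = sqrt (1 + t\<^sup>2)" for t :: real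
    have "\<bar>c s\<bar> \<le> (\<Sum>i\<in>I. (if s = a i then p i else 0) + (if s = b i then q i else 0))" for s
      unfolding c_def
    proof (intro order_trans[OF sum_abs] sum_mono)
      fix i assume "i \<in> I"
      from pq[OF this] show "\<bar>(if s = a i then p i else 0) - (if s = b i then q i else 0)\<bar>
          \<le> (if s = a i then p i else 0) + (if s = b i then q i else 0)" by auto
    qed
    then have "(\<Sum>s\<in>T. \<bar>c s\<bar> * w s)
        \<le> (\<Sum>s\<in>T. (\<Sum>i\<in>I. (if s = a i then p i else 0) + (if s = b i then q i else 0)) * w s)"
      by (intro sum_mono mult_right_mono) (auto simp: w_def)
    also have "\<dots> = (\<Sum>i\<in>I. p i * w (a i)) + (\<Sum>i\<in>I. q i * w (b i))"
      using collect[of a p w] collect[of b q w]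
      by (simp add: T_def sum.distrib sum_distrib_right distrib_right)
    also have "\<dots> = knot_cost n \<theta>"
      unfolding knot_cost_def I_def[symmetric] sum.distrib[symmetric]
    proof (intro sum.cong refl)
      fix i assume i: "i \<in> I"
      then have "i \<in> {1..n}" by (auto simp: I_def)
      from knot_cone_hinge(2)[OF x _ this \<theta>I(1)[OF i]] knot_cone_hinge(2)[OF x _ this \<theta>I(2)[OF i]] i
      show "p i * w (a i) + q i * w (b i) = cmod (fst (\<theta> i)) + cmod (snd (\<theta> i))"
        by (simp add: p_def q_def a_def b_def I_def w_def)
    qed
    finally show ?thesis
      unfolding f_def weighted_TV_linear_spline[OF T] w_def by (rule ennreal_leI)
  qed
  ultimately show ?thesis by (rule that)
qed

theorem theorem2:
  fixes n :: nat and x y :: "nat \<Rightarrow> real"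
  assumes "n \<ge> 2"
    and "strict_mono_on {1..n} x"
  shows "\<exists>!f :: real \<Rightarrow> real. is_arg_min weighted_TV (\<lambda>g. \<forall>i\<in>{1..n}. g (x i) = y i) f"
proof -
  obtain k \<theta> where k: "(\<Sum>j\<in>{1..n}. k j) = 0" "(\<Sum>j\<in>{1..n}. k j * x j) = 0"
    and le: "\<And>t. \<bar>\<Sum>j\<in>{1..n}. k j * max 0 (x j - t)\<bar> \<le> sqrt (1 + t\<^sup>2)"
    and \<theta>: "knots_fit n x y \<theta>" "knot_cost n \<theta> = (\<Sum>j\<in>{1..n}. k j * y j)"
    by (rule knot_duality[OF assms, of y]) blast
  define v where "v = (\<Sum>j\<in>{1..n}. k j * y j)"
  \<comment> \<open>\<open>S\<close> is read off from \<open>k\<close> alone, so it is the same for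
    all minimisers.\<close>
  define S where "S = {t. \<bar>\<Sum>j\<in>{1..n}. k j * max 0 (x j - t)\<bar> = sqrt (1 + t\<^sup>2)}"
  have v: "0 \<le> v" using knot_cost_nonneg[of n \<theta>] \<theta>(2) by (simp add: v_def)
  note dual = dual_certificate[OF finite_atLeastAtMost k le]
  have val: "(\<Sum>j\<in>{1..n}. k j * f (x j)) = v" if "\<forall>i\<in>{1..n}. f (x i) = y i" for f
    using that by (simp add: v_def)
  have lower: "ennreal v \<le> weighted_TV f" if "\<forall>i\<in>{1..n}. f (x i) = y i" for f
    using dual(1)[of f] val[OF that] by simp
  have affine: "affine_off f S" if "\<forall>i\<in>{1..n}. f (x i) = y i" "weighted_TV f = ennreal v" for f
    using dual(2)[of f] val[OF that(1)] that(2) v unfolding S_def by simp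
  \<comment> \<open>The spline of \<open>\<theta>\<close> costs at most \<open>v\<close> by the
    choice of \<open>k\<close> and \<open>\<theta>\<close>, and at least \<open>v\<close> by the
    certificate.\<close>
  obtain f where f: "\<forall>i\<in>{1..n}. f (x i) = y i" "weighted_TV f = ennreal v"
    using knots_fit_spline[OF assms(2) \<theta>(1)] lower \<theta>(2) by (metis antisym v_def)
  show ?thesis
  proof (rule ex1I[of _ f])
    show "is_arg_min weighted_TV (\<lambda>g. \<forall>i\<in>{1..n}. g (x i) = y i) f"
      using f lower by (auto simp: is_arg_min_def not_less)
    fix g assume "is_arg_min weighted_TV (\<lambda>g. \<forall>i\<in>{1..n}. g (x i) = y i) g"
    then have g: "\<forall>i\<in>{1..n}. g (x i) = y i" "weighted_TV g = ennreal v"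
      using f lower[of g] by (auto simp: is_arg_min_def not_less intro: antisym)
    note contacts = hinge_sum_contacts[OF assms k le, folded S_def]
    obtain i where i: "i \<in> {1..<n}" "{x i<..<x (Suc i)} \<inter> S = {}" using contacts(4) by blast
    have d: "affine_off (\<lambda>t. g t - f t) S" "\<And>j. j \<in> {1..n} \<Longrightarrow> g (x j) - f (x j) = 0"
      using affine_off_diff affine f g by auto
    show "g = f"
    proof
      fix t
      have "x i < x (Suc i)" using i by (intro strict_mono_onD[OF assms(2)]) auto
      \<comment> \<open>The two half-lines overlap in interval \<open>i\<close>, so spreading to
        both sides of this contact-free interval covers the whole line.\<close>
      then consider "x i \<le> t" | "t \<le> x (Suc i)" by linarith
      then have "g t - f t = 0"
      proof cases
        case 1
        then show ?thesis
          using affine_off_zero_right[OF assms(2) d contacts(1,2) i] by blast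
      next
        case 2
        then show ?thesis
          using affine_off_zero_left[OF assms(2) d contacts(1,3) i] by blast
      qed
      then show "g t = f t" by simp
    qed
  qed
qed

end
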